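(* Let $(M,g)$ be an open Riemannian manifold. If $(M,g)$ has a limiting Carleman weight, then there is a smooth positive function $c$ on $M$ such that $(M,cg)$ admits a parallel unit vector field. For simply connected manifolds the converse is also true: if $(M,g)$ is a simply connected open Riemannian manifold and for some smooth positive function $c$ on $M$ the manifold $(M,cg)$ admits a parallel unit vector field, then $(M,g)$ has a limiting Carleman weight.
   Context: All manifolds are smooth ($C^\infty$) and oriented. An open manifold is a manifold without boundary none of whose components is compact. For a smooth real-valued function $\varphi$ on $(M,g)$ define on $T^*M$ $$p_\varphi(x,\xi)=|\xi|^2-|d\varphi|^2+2i\langle \xi,d\varphi\rangle,$$ with inner products and norms those induced by $g$ on covectors; this is the semiclassical principal symbol of $e^{\varphi/h}(-h^2\Delta_g)e^{-\varphi/h}$, where $\Delta_g$ is the Laplace-Beltrami operator and $h>0$ a small parameter. A smooth real-valued function $\varphi$ on an open manifold $(M,g)$ is a limiting Carleman weight if $d\varphi$ vanishes nowhere and the Poisson bracket $\{\overline{p_\varphi},p_\varphi\}$ vanishes at every point of $T^*M$ where $p_\varphi=0$. A vector field $X$ is parallel if $DX=0$ for the Levi-Civita connection $D$, and unit if $|X|=1$ everywhere. *)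

theory Defs
  imports "HOL-Analysis.Analysis"
begin

text \<open>
  Conventions. A manifold lives on an open subset of a Hausdorff second countable space
  and is given by an oriented smooth atlas with values in \<open>real ^ 'n\<close>. Since index types are
  nonempty, the dimension is at least 1; a 0-dimensional manifold without compact components
  is empty. Tensor fields are families of components, one for each chart of the atlas,
  regarded as functions on the chart domain and related by the tensor transformation laws.
\<close>

subsection \<open>Smooth maps between normed spaces\<close>

text \<open>Used on open subsets of Euclidean spaces, where \<open>Ck_on n S\<close> is the class \<open>C\<^sup>n(S)\<close>.\<close>

primrec Ck_on :: "nat \<Rightarrow> 'a::real_normed_vector set \<Rightarrow> ('a \<Rightarrow> 'b::real_normed_vector) \<Rightarrow> bool" where
  "Ck_on 0 S f \<longleftrightarrow> continuous_on S f"
| "Ck_on (Suc n) S f \<longleftrightarrow>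
     (\<forall>x\<in>S. f differentiable (at x)) \<and> (\<forall>v. Ck_on n S (\<lambda>x. frechet_derivative f (at x) v))"

definition smooth_on :: "'a::real_normed_vector set \<Rightarrow> ('a \<Rightarrow> 'b::real_normed_vector) \<Rightarrow> bool" where
  "smooth_on S f \<longleftrightarrow> (\<forall>n. Ck_on n S f)"

subsection \<open>Manifolds\<close>

text \<open>Only the restriction of the coordinate map to the chart domain is relevant.\<close>

type_synonym ('a, 'n) chart = "'a set \<times> ('a \<Rightarrow> real ^ 'n)"

abbreviation chart_dom :: "('a, 'n) chart \<Rightarrow> 'a set" where
  "chart_dom \<equiv> fst"

abbreviation coord :: "('a, 'n) chart \<Rightarrow> 'a \<Rightarrow> real ^ 'n" where
  "coord \<equiv> snd"

definition param :: "('a, 'n) chart \<Rightarrow> real ^ 'n \<Rightarrow> 'a" where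
  "param x = inv_into (chart_dom x) (coord x)"

definition is_chart :: "('a::topological_space, 'n::finite) chart \<Rightarrow> bool" where
  "is_chart x \<longleftrightarrow> open (chart_dom x) \<and> open (coord x ` chart_dom x) \<and>
     homeomorphism (chart_dom x) (coord x ` chart_dom x) (coord x) (param x)"

definition transition_jacobian ::
    "('a, 'n::finite) chart \<Rightarrow> ('a, 'n) chart \<Rightarrow> 'a \<Rightarrow> real ^ 'n ^ 'n" where
  "transition_jacobian x y p = jacobian (coord y \<circ> param x) (at (coord x p))"

definition points :: "('a, 'n) chart set \<Rightarrow> 'a set" where
  "points A = (\<Union>x\<in>A. chart_dom x)"

definition oriented_manifold ::
    "('a::{second_countable_topology,t2_space}, 'n::finite) chart set \<Rightarrow> bool" where
  "oriented_manifold A \<longleftrightarrow>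
     (\<forall>x\<in>A. is_chart x) \<and>
     (\<forall>x\<in>A. \<forall>y\<in>A. smooth_on (coord x ` (chart_dom x \<inter> chart_dom y)) (coord y \<circ> param x)) \<and>
     (\<forall>x\<in>A. \<forall>y\<in>A. \<forall>p\<in>chart_dom x \<inter> chart_dom y. det (transition_jacobian x y p) > 0)"

definition open_manifold ::
    "('a::{second_countable_topology,t2_space}, 'n::finite) chart set \<Rightarrow> bool" where
  "open_manifold A \<longleftrightarrow> oriented_manifold A \<and> (\<forall>C\<in>components (points A). \<not> compact C)"

subsection \<open>Functions, vector fields and Riemannian metrics\<close>

definition smooth_in_chart ::
    "('a, 'n::finite) chart \<Rightarrow> ('a \<Rightarrow> 'b::real_normed_vector) \<Rightarrow> bool" where
  "smooth_in_chart x f \<longleftrightarrow> smooth_on (coord x ` chart_dom x) (f \<circ> param x)"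

definition smooth_function :: "('a, 'n::finite) chart set \<Rightarrow> ('a \<Rightarrow> real) \<Rightarrow> bool" where
  "smooth_function A f \<longleftrightarrow> (\<forall>x\<in>A. smooth_in_chart x f)"

text \<open>The coordinate derivative of \<open>f\<close> with respect to the \<open>i\<close>-th coordinate of \<open>x\<close>.\<close>

definition pderiv_chart ::
    "('a, 'n::finite) chart \<Rightarrow> 'n \<Rightarrow> ('a \<Rightarrow> 'b::real_normed_vector) \<Rightarrow> 'a \<Rightarrow> 'b" where
  "pderiv_chart x i f p = frechet_derivative (f \<circ> param x) (at (coord x p)) (axis i 1)"

definition differential :: "('a \<Rightarrow> real) \<Rightarrow> ('a, 'n::finite) chart \<Rightarrow> 'a \<Rightarrow> real ^ 'n" where
  "differential f x p = (\<chi> i. pderiv_chart x i f p)"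

type_synonym ('a, 'n) vector_components = "('a, 'n) chart \<Rightarrow> 'a \<Rightarrow> real ^ 'n"

type_synonym ('a, 'n) metric_components = "('a, 'n) chart \<Rightarrow> 'a \<Rightarrow> real ^ 'n ^ 'n"

definition vector_field ::
    "('a, 'n::finite) chart set \<Rightarrow> ('a, 'n) vector_components \<Rightarrow> bool" where
  "vector_field A X \<longleftrightarrow>
     (\<forall>x\<in>A. smooth_in_chart x (X x)) \<and>
     (\<forall>x\<in>A. \<forall>y\<in>A. \<forall>p\<in>chart_dom x \<inter> chart_dom y. X y p = transition_jacobian x y p *v X x p)"

definition riemannian_metric ::
    "('a, 'n::finite) chart set \<Rightarrow> ('a, 'n) metric_components \<Rightarrow> bool" where
  "riemannian_metric A g \<longleftrightarrow>
     (\<forall>x\<in>A. smooth_in_chart x (g x)) \<and>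
     (\<forall>x\<in>A. \<forall>p\<in>chart_dom x. transpose (g x p) = g x p
        \<and> (\<forall>v. v \<noteq> 0 \<longrightarrow> v \<bullet> (g x p *v v) > 0)) \<and>
     (\<forall>x\<in>A. \<forall>y\<in>A. \<forall>p\<in>chart_dom x \<inter> chart_dom y.
        g x p = transpose (transition_jacobian x y p) ** g y p ** transition_jacobian x y p)"

definition conformal_metric ::
    "('a \<Rightarrow> real) \<Rightarrow> ('a, 'n::finite) metric_components \<Rightarrow> ('a, 'n) metric_components" where
  "conformal_metric c g = (\<lambda>x p. c p *\<^sub>R g x p)"

definition coinner ::
    "('a, 'n::finite) metric_components \<Rightarrow> ('a, 'n) chart \<Rightarrow> 'a \<Rightarrow> real ^ 'n \<Rightarrow> real ^ 'n \<Rightarrow> real" where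
  "coinner g x p \<xi> \<eta> = \<xi> \<bullet> (matrix_inv (g x p) *v \<eta>)"

subsection \<open>Levi-Civita connection\<close>

text \<open>\<open>christoffel g x p k i j\<close> is the Christoffel symbol with upper index \<open>k\<close> and lower
  indices \<open>i\<close>, \<open>j\<close>.\<close>

definition christoffel ::
    "('a, 'n::finite) metric_components \<Rightarrow> ('a, 'n) chart \<Rightarrow> 'a \<Rightarrow> 'n \<Rightarrow> 'n \<Rightarrow> 'n \<Rightarrow> real" where
  "christoffel g x p k i j =
     (\<Sum>l\<in>UNIV. matrix_inv (g x p) $ k $ l *
        (pderiv_chart x i (\<lambda>q. g x q $ j $ l) p
         + pderiv_chart x j (\<lambda>q. g x q $ i $ l) p
         - pderiv_chart x l (\<lambda>q. g x q $ i $ j) p)) / 2"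

text \<open>These are the coefficients of the unique connection that is torsion free and
  compatible with \<open>g\<close>.\<close>

lemma christoffel_levi_civita:
  fixes g :: "('a::{second_countable_topology,t2_space}, 'n::finite) metric_components"
  assumes M: "oriented_manifold A" and g: "riemannian_metric A g" and x: "x \<in> A" and p: "p \<in> chart_dom x"
  shows "(\<forall>k i j. \<Gamma> k i j = \<Gamma> k j i) \<and>
         (\<forall>k i j. pderiv_chart x k (\<lambda>q. g x q $ i $ j) p =
            (\<Sum>l\<in>UNIV. \<Gamma> l k i * g x p $ l $ j) + (\<Sum>l\<in>UNIV. \<Gamma> l k j * g x p $ i $ l))
     \<longleftrightarrow> (\<forall>k i j. \<Gamma> k i j = christoffel g x p k i j)"
proof -
  define G where "G = g x p"
  define H where "H = matrix_inv G"
  define d where "d k i j = pderiv_chart x k (\<lambda>q. g x q $ i $ j) p" for k i j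
  define L where "L k i j = (\<Sum>l\<in>UNIV. G $ k $ l * \<Gamma> l i j)" for k i j
  have chart: "open (coord x ` chart_dom x)" "\<And>y. y \<in> coord x ` chart_dom x \<Longrightarrow> param x y \<in> chart_dom x"
  proof -
    have "is_chart x"
      using M x unfolding oriented_manifold_def by blast
    then show "open (coord x ` chart_dom x)" "\<And>y. y \<in> coord x ` chart_dom x \<Longrightarrow> param x y \<in> chart_dom x"
      unfolding is_chart_def homeomorphism_def by blast+
  qed
  have gsym: "g x q $ i $ j = g x q $ j $ i" if "q \<in> chart_dom x" for q i j
  proof -
    have "transpose (g x q) = g x q"
      using g x that unfolding riemannian_metric_def by blast
    then have "transpose (g x q) $ j $ i = g x q $ j $ i" by simp
    then show ?thesis by (simp add: transpose_def)
  qed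
  have Gsym: "G $ i $ j = G $ j $ i" for i j
    using gsym[OF p] by (simp add: G_def)
  have dsym: "d k i j = d k j i" for k i j
  proof -
    have "((\<lambda>q. g x q $ i $ j) \<circ> param x has_derivative D) (at (coord x p)) \<longleftrightarrow>
          ((\<lambda>q. g x q $ j $ i) \<circ> param x has_derivative D) (at (coord x p))" for D
    proof -
      have y: "coord x p \<in> coord x ` chart_dom x"
        using p by (rule imageI)
      have eq: "((\<lambda>q. g x q $ i $ j) \<circ> param x) y = ((\<lambda>q. g x q $ j $ i) \<circ> param x) y"
        if "y \<in> coord x ` chart_dom x" for y
        unfolding o_def by (rule gsym[OF chart(2)[OF that]])
      show ?thesis
        by (rule iffI; erule has_derivative_transform_within_open[OF _ chart(1) y]; simp only: eq)
    qed
    then show ?thesis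
      by (simp only: d_def pderiv_chart_def frechet_derivative_def)
  qed
  have "v = 0" if "G *v v = 0" for v
  proof (rule ccontr)
    assume "v \<noteq> 0"
    then have "v \<bullet> (G *v v) > 0"
      using g x p unfolding riemannian_metric_def G_def by blast
    then show False
      by (simp add: that)
  qed
  then have "invertible G"
    unfolding invertible_left_inverse matrix_left_invertible_ker by blast
  then have "G ** H = mat 1 \<and> H ** G = mat 1"
    unfolding H_def matrix_inv_def invertible_def by (rule someI_ex)
  then have HG: "H ** G = mat 1" and GH: "G ** H = mat 1"
    by simp_all
  have raise_lower: "(\<Sum>l\<in>UNIV. H $ k $ l * (\<Sum>m\<in>UNIV. G $ l $ m * f m)) = f k"
    and lower_raise: "(\<Sum>l\<in>UNIV. G $ k $ l * (\<Sum>m\<in>UNIV. H $ l $ m * f m)) = f k" for f k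
  proof -
    have "H *v (G *v (\<chi> m. f m)) = (\<chi> m. f m)" "G *v (H *v (\<chi> m. f m)) = (\<chi> m. f m)"
      by (simp_all add: matrix_vector_mul_assoc HG GH)
    then have "(H *v (G *v (\<chi> m. f m))) $ k = f k" "(G *v (H *v (\<chi> m. f m))) $ k = f k"
      by simp_all
    then show "(\<Sum>l\<in>UNIV. H $ k $ l * (\<Sum>m\<in>UNIV. G $ l $ m * f m)) = f k"
      "(\<Sum>l\<in>UNIV. G $ k $ l * (\<Sum>m\<in>UNIV. H $ l $ m * f m)) = f k"
      by (simp_all add: matrix_vector_mult_def)
  qed
  have chr: "christoffel g x p k i j = (\<Sum>l\<in>UNIV. H $ k $ l * ((d i j l + d j i l - d l i j) / 2))"
    for k i j
    by (simp add: christoffel_def d_def H_def G_def sum_divide_distrib)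
  have compat: "d k i j = (\<Sum>l\<in>UNIV. \<Gamma> l k i * G $ l $ j) + (\<Sum>l\<in>UNIV. \<Gamma> l k j * G $ i $ l) \<longleftrightarrow>
      d k i j = L j k i + L i k j" for k i j
    by (simp only: L_def Gsym[of _ j] mult.commute[of "\<Gamma> _ _ _"])
  have "(\<forall>k i j. \<Gamma> k i j = \<Gamma> k j i) \<and> (\<forall>k i j. d k i j = L j k i + L i k j) \<longleftrightarrow>
      (\<forall>k i j. \<Gamma> k i j = christoffel g x p k i j)"
  proof (intro iffI conjI allI)
    fix k i j
    assume *: "(\<forall>k i j. \<Gamma> k i j = \<Gamma> k j i) \<and> (\<forall>k i j. d k i j = L j k i + L i k j)"
    then have Lsym: "L a b c = L a c b" for a b c
      unfolding L_def by (intro sum.cong refl) simp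
    have "(d i j l + d j i l - d l i j) / 2 = L l i j" for l
    proof -
      have "d i j l = L l i j + L j i l" "d j i l = L l j i + L i j l" "d l i j = L j l i + L i l j"
        using * by blast+
      then have "d i j l + d j i l - d l i j = 2 * L l i j"
        by (simp only: Lsym[of l j i] Lsym[of j l i] Lsym[of i l j])
      then show ?thesis
        by simp
    qed
    then have "christoffel g x p k i j = (\<Sum>l\<in>UNIV. H $ k $ l * L l i j)"
      by (simp add: chr)
    also have "\<dots> = \<Gamma> k i j"
      unfolding L_def by (rule raise_lower)
    finally show "\<Gamma> k i j = christoffel g x p k i j" ..
  next
    fix k i j
    assume *: "\<forall>k i j. \<Gamma> k i j = christoffel g x p k i j"
    have L: "L a b c = (d b c a + d c b a - d a b c) / 2" for a b c
      unfolding L_def by (simp only: *[rule_format] chr lower_raise)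
    show "d k i j = L j k i + L i k j"
      using L[of j k i] L[of i k j] dsym[of i j k] dsym[of j i k] dsym[of k i j] by argo
    show "\<Gamma> k i j = \<Gamma> k j i"
      by (simp only: *[rule_format] chr dsym[of _ i j] add.commute[of "d i j _"])
  qed
  then show ?thesis
    by (simp only: compat[unfolded d_def G_def] d_def)
qed

text \<open>The component with upper index \<open>k\<close> of the covariant derivative of \<open>X\<close> in the direction
  of the \<open>i\<close>-th coordinate field.\<close>

definition covariant_derivative ::
    "('a, 'n::finite) metric_components \<Rightarrow> ('a, 'n) vector_components \<Rightarrow>
     ('a, 'n) chart \<Rightarrow> 'a \<Rightarrow> 'n \<Rightarrow> 'n \<Rightarrow> real" where
  "covariant_derivative g X x p i k =
     pderiv_chart x i (\<lambda>q. X x q $ k) p + (\<Sum>j\<in>UNIV. christoffel g x p k i j * X x p $ j)"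

definition parallel_field ::
    "('a, 'n::finite) chart set \<Rightarrow> ('a, 'n) metric_components \<Rightarrow> ('a, 'n) vector_components \<Rightarrow> bool"
  where
  "parallel_field A g X \<longleftrightarrow>
     vector_field A X \<and> (\<forall>x\<in>A. \<forall>p\<in>chart_dom x. \<forall>i k. covariant_derivative g X x p i k = 0)"

definition unit_field ::
    "('a, 'n::finite) chart set \<Rightarrow> ('a, 'n) metric_components \<Rightarrow> ('a, 'n) vector_components \<Rightarrow> bool"
  where
  "unit_field A g X \<longleftrightarrow>
     vector_field A X \<and> (\<forall>x\<in>A. \<forall>p\<in>chart_dom x. sqrt (X x p \<bullet> (g x p *v X x p)) = 1)"

subsection \<open>Limiting Carleman weights\<close>

text \<open>
  A chart \<open>x\<close> of the manifold induces the canonical chart of the cotangent bundle over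
  \<open>chart_dom x\<close>, in which a covector at \<open>p\<close> is the pair of \<open>p\<close> and its component vector \<open>\<xi>\<close>.
  Functions on the cotangent bundle are written in this way, as curried functions of
  \<open>p\<close> and \<open>\<xi>\<close>, and the Poisson bracket is the canonical one, computed in these coordinates.
\<close>

definition poisson_bracket ::
    "('a, 'n::finite) chart \<Rightarrow> ('a \<Rightarrow> real ^ 'n \<Rightarrow> complex) \<Rightarrow> ('a \<Rightarrow> real ^ 'n \<Rightarrow> complex) \<Rightarrow>
     'a \<Rightarrow> real ^ 'n \<Rightarrow> complex" where
  "poisson_bracket x a b p \<xi> =
     (\<Sum>j\<in>UNIV. frechet_derivative (a p) (at \<xi>) (axis j 1) * pderiv_chart x j (\<lambda>q. b q \<xi>) p
              - pderiv_chart x j (\<lambda>q. a q \<xi>) p * frechet_derivative (b p) (at \<xi>) (axis j 1))"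

definition carleman_symbol ::
    "('a, 'n::finite) metric_components \<Rightarrow> ('a \<Rightarrow> real) \<Rightarrow> ('a, 'n) chart \<Rightarrow>
     'a \<Rightarrow> real ^ 'n \<Rightarrow> complex" where
  "carleman_symbol g \<phi> x p \<xi> =
     of_real (coinner g x p \<xi> \<xi>)
     - of_real (coinner g x p (differential \<phi> x p) (differential \<phi> x p))
     + 2 * \<i> * of_real (coinner g x p \<xi> (differential \<phi> x p))"

definition limiting_carleman_weight ::
    "('a, 'n::finite) chart set \<Rightarrow> ('a, 'n) metric_components \<Rightarrow> ('a \<Rightarrow> real) \<Rightarrow> bool" where
  "limiting_carleman_weight A g \<phi> \<longleftrightarrow>
     smooth_function A \<phi> \<and>
     (\<forall>x\<in>A. \<forall>p\<in>chart_dom x. differential \<phi> x p \<noteq> 0) \<and>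
     (\<forall>x\<in>A. \<forall>p\<in>chart_dom x. \<forall>\<xi>. carleman_symbol g \<phi> x p \<xi> = 0 \<longrightarrow>
        poisson_bracket x (\<lambda>q \<eta>. cnj (carleman_symbol g \<phi> x q \<eta>)) (carleman_symbol g \<phi> x) p \<xi> = 0)"

end

theory Submission
  imports Defs
begin

text \<open>
  For \<open>v\<close> dual to \<open>\<xi>\<close> and \<open>X = grad \<phi>\<close>, the bracket of the conjugate symbol with the symbol is
  \<open>8i (D\<^sup>2\<phi>(v, v) + D\<^sup>2\<phi>(X, X))\<close>, and the symbol vanishes iff \<open>v\<close> is orthogonal to \<open>X\<close> and of the
  same length. This condition on \<open>\<phi>\<close> is conformally invariant. After rescaling by
  \<open>c = |d\<phi>|\<^sup>2\<close> the gradient is a unit field, so \<open>D\<^sup>2\<phi>(X, _) = 0\<close>; the condition then kills \<open>D\<^sup>2\<phi>\<close>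
  on the orthogonal complement of \<open>X\<close> too, hence \<open>D\<^sup>2\<phi> = 0\<close>, that is, \<open>X\<close> is parallel. Conversely,
  the dual form of a parallel field is closed, so on a simply connected manifold it is \<open>d\<phi>\<close>
  for some \<open>\<phi>\<close>, and \<open>D\<^sup>2\<phi> = 0\<close>.
\<close>

subsection \<open>Smooth functions\<close>

text \<open>Covectors are written as \<open>g x p *v v\<close>, and the connection enters only
  through \<open>covariant_form\<close>, where the upper index is lowered. The inverse metric then
  cancels from most formulas, and the local work consists of identities between linear maps at one
  point of one chart. Conformal invariance rests on a cancellation. Let \<open>X\<close> be the old
  gradient and \<open>v\<close> orthogonal to \<open>X\<close> and of the same length. Rescaling the
  metric adds some \<open>k\<close> to \<open>D\<^sup>2\<phi>(v, v)\<close> and subtracts the same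
  \<open>k\<close> from \<open>D\<^sup>2\<phi>(X, X)\<close>, so the sum in the bracket is
  unchanged. The obstacle in the converse is that loops and homotopies are merely continuous, so a
  form cannot be integrated along them by a line integral. Instead, local primitives are continued
  along paths, and homotopy invariance comes from subdividing the square.\<close>

lemma frechet_derivative_cong_open:
  assumes "open S" "x \<in> S" "\<And>y. y \<in> S \<Longrightarrow> f y = g y"
  shows "frechet_derivative f (at x) = frechet_derivative g (at x)"
proof -
  \<comment> \<open>\<open>frechet_derivative\<close> is a choice among all derivatives, so
    equivalence of the two predicates suffices, even where no derivative exists.\<close>
  have "(f has_derivative D) (at x) \<longleftrightarrow> (g has_derivative D) (at x)" for D
    using has_derivative_transform_within_open[OF _ assms(1,2), of f D UNIV g]
      has_derivative_transform_within_open[OF _ assms(1,2), of g D UNIV f] assms(3) by auto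
  then show ?thesis by (simp add: frechet_derivative_def)
qed

lemma Ck_on_cong:
  assumes "open S" "\<And>x. x \<in> S \<Longrightarrow> f x = g x"
  shows "Ck_on n S f \<longleftrightarrow> Ck_on n S g"
  using assms(2)
proof (induction n arbitrary: f g)
  case 0
  then show ?case by (simp cong: continuous_on_cong)
next
  case (Suc n)
  have "f differentiable (at x) \<longleftrightarrow> g differentiable (at x)" if "x \<in> S" for x
    using has_derivative_transform_within_open[OF _ assms(1) that, of f _ UNIV g]
      has_derivative_transform_within_open[OF _ assms(1) that, of g _ UNIV f] Suc.prems
    by (auto simp: differentiable_def)
  moreover have "Ck_on n S (\<lambda>x. frechet_derivative f (at x) v) \<longleftrightarrow>
      Ck_on n S (\<lambda>x. frechet_derivative g (at x) v)" for v
    using frechet_derivative_cong_open[OF assms(1) _ Suc.prems] by (intro Suc.IH) simp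
  ultimately show ?case by simp
qed

text \<open>\<open>Ck_on\<close> refers to the chosen derivative. Uniqueness of derivatives lets any
  explicit formula \<open>f'\<close> take its place.\<close>

lemma Ck_on_SucI:
  assumes "open S" "\<And>x. x \<in> S \<Longrightarrow> (f has_derivative f' x) (at x)"
    and "\<And>v. Ck_on n S (\<lambda>x. f' x v)"
  shows "Ck_on (Suc n) S f"
proof -
  have "Ck_on n S (\<lambda>x. frechet_derivative f (at x) v)" for v
    using assms(3)[of v] Ck_on_cong[OF assms(1), of "\<lambda>x. f' x v" "\<lambda>x. frechet_derivative f (at x) v"]
      frechet_derivative_at[OF assms(2)] by simp
  then show ?thesis
    using assms(2) by (auto simp: differentiable_def)
qed

lemma Ck_on_Suc_imp_has_derivative:
  "Ck_on (Suc n) S f \<Longrightarrow> x \<in> S \<Longrightarrow> (f has_derivative frechet_derivative f (at x)) (at x)"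
  by (simp add: frechet_derivative_works)

lemma Ck_on_Suc_frechet_derivative:
  "Ck_on (Suc n) S f \<Longrightarrow> Ck_on n S (\<lambda>x. frechet_derivative f (at x) v)"
  by simp

lemma Ck_on_SucD:
  assumes "open S" "Ck_on (Suc n) S f"
  shows "Ck_on n S f"
  using assms(2)
proof (induction n arbitrary: f)
  case 0
  then show ?case
    by (auto intro!: continuous_at_imp_continuous_on differentiable_imp_continuous_within)
next
  case (Suc n)
  have "Ck_on n S (\<lambda>x. frechet_derivative f (at x) v)" for v
    by (intro Suc.IH Ck_on_Suc_frechet_derivative Suc.prems)
  with Suc.prems show ?case by simp
qed

lemma Ck_on_const: "Ck_on n S (\<lambda>x. c)"
proof (induction n arbitrary: c)
  case (Suc n)
  then show ?case by simp
qed simp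

lemma Ck_on_bounded_linear:
  assumes "bounded_linear L" "open S" "Ck_on n S f"
  shows "Ck_on n S (\<lambda>x. L (f x))"
  using assms(3)
proof (induction n arbitrary: f)
  case 0
  then show ?case
    using bounded_linear.continuous_on[OF assms(1)] by simp
next
  case (Suc n)
  show ?case
  proof (rule Ck_on_SucI[OF assms(2)])
    fix x assume "x \<in> S"
    show "((\<lambda>x. L (f x)) has_derivative (\<lambda>h. L (frechet_derivative f (at x) h))) (at x)"
      by (rule bounded_linear.has_derivative[OF assms(1)])
        (rule Ck_on_Suc_imp_has_derivative[OF Suc.prems \<open>x \<in> S\<close>])
  qed (use Suc in simp)
qed

lemma Ck_on_add:
  assumes "open S" "Ck_on n S f" "Ck_on n S g"
  shows "Ck_on n S (\<lambda>x. f x + g x)"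
  using assms(2,3)
proof (induction n arbitrary: f g)
  case 0
  then show ?case by (simp add: continuous_on_add)
next
  case (Suc n)
  show ?case
    by (rule Ck_on_SucI[OF assms(1) has_derivative_add[OF
            Ck_on_Suc_imp_has_derivative[OF Suc.prems(1)] Ck_on_Suc_imp_has_derivative[OF Suc.prems(2)]]])
      (use Suc in simp_all)
qed

text \<open>The product rule pairs each factor with the derivative of the other. So the
  undifferentiated factors are needed in class \<open>n\<close> too, and the induction must range
  over both functions. Products, scalings, inner products and matrix actions are all
  instances.\<close>

lemma Ck_on_bounded_bilinear:
  assumes B: "bounded_bilinear B" and S: "open S" "Ck_on n S f" "Ck_on n S g"
  shows "Ck_on n S (\<lambda>x. B (f x) (g x))"
  using S(2,3)
proof (induction n arbitrary: f g)
  case 0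
  then show ?case by (simp add: bounded_bilinear.continuous_on[OF B])
next
  case (Suc n)
  note f = Ck_on_SucD[OF S(1) Suc.prems(1)] and g = Ck_on_SucD[OF S(1) Suc.prems(2)]
  show ?case
    by (rule Ck_on_SucI[OF S(1) bounded_bilinear.FDERIV[OF B
            Ck_on_Suc_imp_has_derivative[OF Suc.prems(1)] Ck_on_Suc_imp_has_derivative[OF Suc.prems(2)]]])
      (use Suc f g in \<open>auto intro!: Ck_on_add[OF S(1)] Suc.IH\<close>)
qed

lemma Ck_on_inverse:
  fixes f :: "'a::real_normed_vector \<Rightarrow> real"
  assumes S: "open S" "Ck_on n S f" "\<And>x. x \<in> S \<Longrightarrow> f x \<noteq> 0"
  shows "Ck_on n S (\<lambda>x. inverse (f x))"
  using S(2,3)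
proof (induction n arbitrary: f)
  case 0
  then show ?case by (simp add: continuous_on_inverse)
next
  case (Suc n)
  note f = Suc.IH[OF Ck_on_SucD[OF S(1) Suc.prems(1)] Suc.prems(2)]
  note mult = Ck_on_bounded_bilinear[OF bounded_bilinear_mult S(1)]
  show ?case
  proof (rule Ck_on_SucI[OF S(1), where
        f' = "\<lambda>x h. - (inverse (f x) * frechet_derivative f (at x) h * inverse (f x))"])
    fix x assume "x \<in> S"
    show "((\<lambda>x. inverse (f x)) has_derivative
        (\<lambda>h. - (inverse (f x) * frechet_derivative f (at x) h * inverse (f x)))) (at x)"
      using Suc.prems(2)[OF \<open>x \<in> S\<close>] Ck_on_Suc_imp_has_derivative[OF Suc.prems(1) \<open>x \<in> S\<close>]
      by (rule Deriv.has_derivative_inverse)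
  next
    show "Ck_on n S (\<lambda>x. - (inverse (f x) * frechet_derivative f (at x) v * inverse (f x)))" for v
      by (intro Ck_on_bounded_linear[OF bounded_linear_minus[OF bounded_linear_ident] S(1)] mult f
          Ck_on_Suc_frechet_derivative Suc.prems(1))
  qed
qed

section \<open>Closure properties of smooth functions on an open set, up to matrix inversion\<close>

context
  fixes S :: "'a::real_normed_vector set"
  assumes S: "open S"
begin

lemma smooth_on_cong: "(\<And>x. x \<in> S \<Longrightarrow> f x = g x) \<Longrightarrow> smooth_on S f \<longleftrightarrow> smooth_on S g"
  unfolding smooth_on_def using Ck_on_cong[OF S] by blast

text \<open>One derivative that is smooth in every fixed direction yields all orders. This is how a
  primitive of a smooth form will be seen to be smooth.\<close>

lemma smooth_onI:
  assumes "\<And>x. x \<in> S \<Longrightarrow> (f has_derivative f' x) (at x)" "\<And>v. smooth_on S (\<lambda>x. f' x v)"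
  shows "smooth_on S f"
  unfolding smooth_on_def
proof
  fix n
  have "Ck_on (Suc n) S f"
    using assms by (intro Ck_on_SucI[OF S, where f' = f']) (auto simp: smooth_on_def)
  then show "Ck_on n S f" by (rule Ck_on_SucD[OF S])
qed

lemma smooth_on_has_derivative:
  "smooth_on S f \<Longrightarrow> x \<in> S \<Longrightarrow> (f has_derivative frechet_derivative f (at x)) (at x)"
  unfolding smooth_on_def using Ck_on_Suc_imp_has_derivative by blast

lemma smooth_on_frechet_derivative:
  "smooth_on S f \<Longrightarrow> smooth_on S (\<lambda>x. frechet_derivative f (at x) v)"
  unfolding smooth_on_def using Ck_on.simps(2) by blast

lemma smooth_on_continuous_on: "smooth_on S f \<Longrightarrow> continuous_on S f"
  unfolding smooth_on_def using Ck_on.simps(1) by blast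

lemma smooth_on_const: "smooth_on S (\<lambda>x. c)"
  by (simp add: smooth_on_def Ck_on_const)

lemma smooth_on_bounded_linear:
  "bounded_linear L \<Longrightarrow> smooth_on S f \<Longrightarrow> smooth_on S (\<lambda>x. L (f x))"
  unfolding smooth_on_def using Ck_on_bounded_linear[OF _ S] by blast

lemma smooth_on_add: "smooth_on S f \<Longrightarrow> smooth_on S g \<Longrightarrow> smooth_on S (\<lambda>x. f x + g x)"
  unfolding smooth_on_def using Ck_on_add[OF S] by blast

lemma smooth_on_bounded_bilinear:
  "bounded_bilinear B \<Longrightarrow> smooth_on S f \<Longrightarrow> smooth_on S g \<Longrightarrow> smooth_on S (\<lambda>x. B (f x) (g x))"
  unfolding smooth_on_def using Ck_on_bounded_bilinear[OF _ S] by blast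

lemma smooth_on_mult:
  fixes f g :: "'a \<Rightarrow> real"
  shows "smooth_on S f \<Longrightarrow> smooth_on S g \<Longrightarrow> smooth_on S (\<lambda>x. f x * g x)"
  by (rule smooth_on_bounded_bilinear[OF bounded_bilinear_mult])

lemma smooth_on_inverse:
  fixes f :: "'a \<Rightarrow> real"
  shows "smooth_on S f \<Longrightarrow> (\<And>x. x \<in> S \<Longrightarrow> f x \<noteq> 0) \<Longrightarrow> smooth_on S (\<lambda>x. inverse (f x))"
  unfolding smooth_on_def using Ck_on_inverse[OF S] by blast

lemma smooth_on_sum: "(\<And>i. i \<in> I \<Longrightarrow> smooth_on S (f i)) \<Longrightarrow> smooth_on S (\<lambda>x. \<Sum>i\<in>I. f i x)"
  by (induction I rule: infinite_finite_induct) (auto intro: smooth_on_const smooth_on_add)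

lemma smooth_on_prod:
  fixes f :: "'i \<Rightarrow> 'a \<Rightarrow> real"
  shows "(\<And>i. i \<in> I \<Longrightarrow> smooth_on S (f i)) \<Longrightarrow> smooth_on S (\<lambda>x. \<Prod>i\<in>I. f i x)"
  by (induction I rule: infinite_finite_induct) (auto intro: smooth_on_const smooth_on_mult)

lemma smooth_on_nth: "smooth_on S f \<Longrightarrow> smooth_on S (\<lambda>x. f x $ i)"
  by (rule smooth_on_bounded_linear[OF bounded_linear_vec_nth])

lemma smooth_on_vec:
  fixes f :: "'a \<Rightarrow> 'b::real_normed_vector ^ 'n::finite"
  assumes "\<And>i. smooth_on S (\<lambda>x. f x $ i)"
  shows "smooth_on S f"
proof -
  have "bounded_linear (\<lambda>b::'b. axis i b :: 'b ^ 'n)" for i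
    by (rule bounded_linear_intro[where K = 1])
      (auto simp: axis_def vec_eq_iff norm_vec_def L2_set_def if_distrib if_distribR cong: if_cong)
  then have "smooth_on S (\<lambda>x. \<Sum>i\<in>UNIV. axis i (f x $ i))"
    by (intro smooth_on_sum smooth_on_bounded_linear[OF _ assms])
  moreover have "(\<Sum>i\<in>UNIV. axis i (f x $ i)) = f x" for x
    by (simp add: vec_eq_iff axis_def if_distrib cong: if_cong)
  ultimately show ?thesis by simp
qed

lemma smooth_on_det:
  fixes f :: "'a \<Rightarrow> real ^ 'n::finite ^ 'n"
  assumes "smooth_on S f"
  shows "smooth_on S (\<lambda>x. det (f x))"
  unfolding det_def
  by (intro smooth_on_sum smooth_on_mult smooth_on_const smooth_on_prod smooth_on_nth assms)

text \<open>By Cramer's rule the entries of the inverse are quotients of determinants, which are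
  polynomials in the entries.\<close>

lemma smooth_on_matrix_inv:
  fixes f :: "'a \<Rightarrow> real ^ 'n::finite ^ 'n"
  assumes f: "smooth_on S f" and inv: "\<And>x. x \<in> S \<Longrightarrow> det (f x) \<noteq> 0"
  shows "smooth_on S (\<lambda>x. matrix_inv (f x))"
proof (intro smooth_on_vec)
  fix i j
  \<comment> \<open>\<open>f x\<close> with column \<open>i\<close> replaced by the
    \<open>j\<close>-th unit vector.\<close>
  define C where "C x = (\<chi> k l. if l = i then axis j 1 $ k else f x $ k $ l)" for x
  have eq: "matrix_inv (f x) $ i $ j = det (C x) * inverse (det (f x))" if "x \<in> S" for x
  proof -
    have "invertible (f x)" using inv[OF that] by (simp add: invertible_det_nz)
    then have "f x ** matrix_inv (f x) = mat 1"
      unfolding invertible_def matrix_inv_def by (rule someI2_ex) simp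
    then have "f x *v (matrix_inv (f x) *v axis j 1) = axis j 1"
      by (simp add: matrix_vector_mul_assoc)
    then have "(matrix_inv (f x) *v axis j 1) $ i = det (C x) / det (f x)"
      using cramer[OF inv[OF that]] by (simp add: C_def)
    then show ?thesis
      by (simp add: matrix_vector_mult_basis column_def divide_inverse)
  qed
  have "smooth_on S (\<lambda>x. C x $ k $ l)" for k l
    by (cases "l = i") (simp_all add: C_def smooth_on_const smooth_on_nth f)
  then have "smooth_on S C" by (intro smooth_on_vec)
  then have "smooth_on S (\<lambda>x. det (C x) * inverse (det (f x)))"
    by (intro smooth_on_mult smooth_on_inverse smooth_on_det inv f)
  then show "smooth_on S (\<lambda>x. matrix_inv (f x) $ i $ j)"
    using smooth_on_cong[of "\<lambda>x. matrix_inv (f x) $ i $ j", OF eq] by simp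
qed

end

section \<open>Symmetry of mixed second derivatives\<close>

lemma smooth_second_derivative_symmetric:
  fixes f :: "'a::real_normed_vector \<Rightarrow> real"
  assumes S: "open S" "smooth_on S f" "x \<in> S"
  shows "frechet_derivative (\<lambda>y. frechet_derivative f (at y) v) (at x) w =
    frechet_derivative (\<lambda>y. frechet_derivative f (at y) w) (at x) v"
proof -
  define D2 where "D2 v w y = frechet_derivative (\<lambda>y. frechet_derivative f (at y) v) (at y) w" for v w y
  have cont: "continuous_on S (D2 v w)" for v w
    unfolding D2_def
    by (intro smooth_on_continuous_on smooth_on_frechet_derivative S)
  obtain e where e: "e > 0" "ball x e \<subseteq> S"
    using S openE by blast
  text \<open>Both mixed derivatives are approximated by the same second difference.\<close>
  have approx: "\<exists>d>0. \<forall>t. 0 < t \<and> t < d \<longrightarrow>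
     \<bar>(f (x + t *\<^sub>R v + t *\<^sub>R w) - f (x + t *\<^sub>R v) - f (x + t *\<^sub>R w) + f x) / (t * t) - D2 v w x\<bar> < r"
    if "r > 0" for v w r
  proof -
    obtain d0 where d0: "d0 > 0" "\<And>y. y \<in> S \<Longrightarrow> dist y x < d0 \<Longrightarrow> \<bar>D2 v w y - D2 v w x\<bar> < r"
      using cont[of v w] S(3) \<open>r > 0\<close> unfolding continuous_on_iff dist_real_def by blast
    \<comment> \<open>For \<open>t < d\<close> the whole parallelogram spanned by
      \<open>t *\<^sub>R v\<close> and \<open>t *\<^sub>R w\<close> stays within
      \<open>t * K\<close> of \<open>x\<close>. The summand 1 keeps \<open>K\<close> positive when
      both vectors vanish.\<close>
    define K where "K = norm v + norm w + 1"
    have K: "K > 0" unfolding K_def by (simp add: add_nonneg_pos)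
    define d where "d = min e d0 / K"
    have "d > 0" using K e d0 by (simp add: d_def)
    moreover have "\<bar>(f (x + t *\<^sub>R v + t *\<^sub>R w) - f (x + t *\<^sub>R v) - f (x + t *\<^sub>R w) + f x) / (t * t) - D2 v w x\<bar> < r"
      if t: "0 < t" "t < d" for t
    proof -
      have near: "norm (a *\<^sub>R v + b *\<^sub>R w) < min e d0" if "0 \<le> a" "a \<le> t" "0 \<le> b" "b \<le> t" for a b
      proof -
        have "norm (a *\<^sub>R v + b *\<^sub>R w) \<le> a * norm v + b * norm w"
          using norm_triangle_ineq[of "a *\<^sub>R v" "b *\<^sub>R w"] that by simp
        also have "\<dots> \<le> t * norm v + t * norm w"
          using that by (intro add_mono mult_right_mono) auto
        also have "\<dots> \<le> t * K" using t unfolding K_def by (simp add: algebra_simps)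
        also have "\<dots> < min e d0" using t K unfolding d_def by (simp add: pos_less_divide_eq)
        finally show ?thesis .
      qed
      have inS: "x + a *\<^sub>R v + b *\<^sub>R w \<in> S" "dist (x + a *\<^sub>R v + b *\<^sub>R w) x < d0"
        if "0 \<le> a" "a \<le> t" "0 \<le> b" "b \<le> t" for a b
      proof -
        have "dist (x + a *\<^sub>R v + b *\<^sub>R w) x = norm (a *\<^sub>R v + b *\<^sub>R w)"
          by (simp add: dist_norm algebra_simps)
        with near[OF that] show "dist (x + a *\<^sub>R v + b *\<^sub>R w) x < d0" "x + a *\<^sub>R v + b *\<^sub>R w \<in> S"
          using e(2) by (auto simp: dist_commute subset_iff)
      qed
      have d1: "((\<lambda>a. f (x + a *\<^sub>R v + b *\<^sub>R w)) has_real_derivative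
          frechet_derivative f (at (x + a *\<^sub>R v + b *\<^sub>R w)) v) (at a)"
        if "0 \<le> a" "a \<le> t" "0 \<le> b" "b \<le> t" for a b
      proof -
        have "((\<lambda>a. f (x + a *\<^sub>R v + b *\<^sub>R w)) has_derivative
           (\<lambda>h. frechet_derivative f (at (x + a *\<^sub>R v + b *\<^sub>R w)) (h *\<^sub>R v))) (at a)"
          by (rule has_derivative_compose[where f = "\<lambda>a. x + a *\<^sub>R v + b *\<^sub>R w" and g = f])
            (auto intro!: derivative_eq_intros smooth_on_has_derivative[OF S(1,2) inS(1)[OF that]])
        then show ?thesis
          unfolding has_field_derivative_def
          by (simp add: linear_simps(5)[OF has_derivative_bounded_linear[OF
                  smooth_on_has_derivative[OF S(1,2) inS(1)[OF that]]]] mult_commute_abs)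
      qed
      have d2: "((\<lambda>b. frechet_derivative f (at (x + a *\<^sub>R v + b *\<^sub>R w)) v) has_real_derivative
          D2 v w (x + a *\<^sub>R v + b *\<^sub>R w)) (at b)"
        if "0 \<le> a" "a \<le> t" "0 \<le> b" "b \<le> t" for a b
      proof -
        note D = smooth_on_has_derivative[OF S(1) smooth_on_frechet_derivative[OF S(1,2)] inS(1)[OF that]]
        have "((\<lambda>b. frechet_derivative f (at (x + a *\<^sub>R v + b *\<^sub>R w)) v) has_derivative
           (\<lambda>h. D2 v (h *\<^sub>R w) (x + a *\<^sub>R v + b *\<^sub>R w))) (at b)"
          unfolding D2_def
          by (rule has_derivative_compose[where f = "\<lambda>b. x + a *\<^sub>R v + b *\<^sub>R w"
                and g = "\<lambda>y. frechet_derivative f (at y) v"])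
            (auto intro!: derivative_eq_intros D)
        then show ?thesis
          unfolding has_field_derivative_def D2_def
          by (simp add: linear_simps(5)[OF has_derivative_bounded_linear[OF D]] mult_commute_abs)
      qed
      \<comment> \<open>The mean value theorem, applied in direction \<open>v\<close> to the
        difference of two parallel edges and then in direction \<open>w\<close>, makes the quotient
        exactly equal to \<open>D2 v w\<close> at a nearby point. Continuity does the rest.\<close>
      obtain a where a: "0 < a" "a < t"
        "(f (x + t *\<^sub>R v + t *\<^sub>R w) - f (x + t *\<^sub>R v + 0 *\<^sub>R w)) -
         (f (x + 0 *\<^sub>R v + t *\<^sub>R w) - f (x + 0 *\<^sub>R v + 0 *\<^sub>R w)) =
         (t - 0) * (frechet_derivative f (at (x + a *\<^sub>R v + t *\<^sub>R w)) v -
            frechet_derivative f (at (x + a *\<^sub>R v + 0 *\<^sub>R w)) v)"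
        using MVT2[OF t(1) DERIV_diff[OF d1 d1], of t 0] t by auto
      obtain b where b: "0 < b" "b < t"
         "frechet_derivative f (at (x + a *\<^sub>R v + t *\<^sub>R w)) v -
            frechet_derivative f (at (x + a *\<^sub>R v + 0 *\<^sub>R w)) v = (t - 0) * D2 v w (x + a *\<^sub>R v + b *\<^sub>R w)"
        using MVT2[OF t(1), of "\<lambda>b. frechet_derivative f (at (x + a *\<^sub>R v + b *\<^sub>R w)) v"
          "\<lambda>b. D2 v w (x + a *\<^sub>R v + b *\<^sub>R w)"] d2 a by auto
      have "(f (x + t *\<^sub>R v + t *\<^sub>R w) - f (x + t *\<^sub>R v) - f (x + t *\<^sub>R w) + f x) / (t * t) =
          D2 v w (x + a *\<^sub>R v + b *\<^sub>R w)"
        using a(3) t unfolding b(3) by (simp add: divide_eq_eq mult.commute algebra_simps)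
      then show ?thesis
        using d0(2)[OF inS[of a b]] a b by simp
    qed
    ultimately show ?thesis by blast
  qed
  have "\<bar>D2 v w x - D2 w v x\<bar> < r" if "r > 0" for r
  proof -
    obtain d1 d2 where d: "d1 > 0" "d2 > 0"
     "\<And>t. 0 < t \<and> t < d1 \<Longrightarrow> \<bar>(f (x + t *\<^sub>R v + t *\<^sub>R w) - f (x + t *\<^sub>R v) - f (x + t *\<^sub>R w) + f x) / (t * t) - D2 v w x\<bar> < r/2"
     "\<And>t. 0 < t \<and> t < d2 \<Longrightarrow> \<bar>(f (x + t *\<^sub>R w + t *\<^sub>R v) - f (x + t *\<^sub>R w) - f (x + t *\<^sub>R v) + f x) / (t * t) - D2 w v x\<bar> < r/2"
      using approx[OF half_gt_zero[OF \<open>r > 0\<close>], of v w] approx[OF half_gt_zero[OF \<open>r > 0\<close>], of w v]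
      by blast
    define t where "t = min d1 d2 / 2"
    have t: "0 < t \<and> t < d1" "0 < t \<and> t < d2" using d by (auto simp: t_def)
    have swap: "f (x + t *\<^sub>R w + t *\<^sub>R v) - f (x + t *\<^sub>R w) - f (x + t *\<^sub>R v) + f x =
       f (x + t *\<^sub>R v + t *\<^sub>R w) - f (x + t *\<^sub>R v) - f (x + t *\<^sub>R w) + f x"
      by (simp add: add.commute add.left_commute)
    show ?thesis using d(3)[OF t(1)] d(4)[OF t(2), unfolded swap] by linarith
  qed
  then have "D2 v w x = D2 w v x"
    by (metis less_irrefl right_minus_eq zero_less_abs_iff)
  then show ?thesis by (simp add: D2_def)
qed

subsection \<open>Geometry in a chart\<close>

lemma bounded_bilinear_matrix_vector_mult:
  "bounded_bilinear (\<lambda>(A :: real ^ 'n::finite ^ 'm::finite) v. A *v v)"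
  unfolding bilinear_conv_bounded_bilinear[symmetric] bilinear_def
  by (auto intro!: linearI simp: algebra_simps scaleR_matrix_vector_assoc)

lemma matrix_inv_works:
  fixes A :: "real ^ 'n::finite ^ 'n"
  assumes "invertible A"
  shows "A ** matrix_inv A = mat 1" "matrix_inv A ** A = mat 1"
proof -
  have "A ** matrix_inv A = mat 1 \<and> matrix_inv A ** A = mat 1"
    using assms unfolding invertible_def matrix_inv_def by (rule someI_ex)
  then show "A ** matrix_inv A = mat 1" "matrix_inv A ** A = mat 1" by auto
qed

lemma matrix_inv_vector_mult:
  fixes A :: "real ^ 'n::finite ^ 'n"
  assumes "invertible A"
  shows "A *v (matrix_inv A *v v) = v" "matrix_inv A *v (A *v v) = v"
  by (simp_all add: matrix_vector_mul_assoc matrix_inv_works[OF assms])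

text \<open>All partial derivatives in one map of the direction, linear for smooth \<open>f\<close>;
  it keeps indices out of the tensor computations.\<close>

definition chart_derivative ::
    "('a, 'n::finite) chart \<Rightarrow> ('a \<Rightarrow> 'b::real_normed_vector) \<Rightarrow> 'a \<Rightarrow> real ^ 'n \<Rightarrow> 'b" where
  "chart_derivative x f p = frechet_derivative (\<lambda>y. f (param x y)) (at (coord x p))"

lemma pderiv_chart_eq: "pderiv_chart x i f p = chart_derivative x f p (axis i 1)"
  by (simp add: pderiv_chart_def chart_derivative_def o_def)

lemma chart_derivativeI:
  "((\<lambda>y. f (param x y)) has_derivative f') (at (coord x p)) \<Longrightarrow> chart_derivative x f p = f'"
  unfolding chart_derivative_def by (rule frechet_derivative_at[symmetric])

lemma smooth_in_chart_iff:
  "smooth_in_chart x f \<longleftrightarrow> smooth_on (coord x ` chart_dom x) (\<lambda>y. f (param x y))"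
  by (simp add: smooth_in_chart_def o_def)

context
  fixes x :: "('a::topological_space, 'n::finite) chart"
  assumes chart: "is_chart x"
begin

lemma open_chart_image: "open (coord x ` chart_dom x)"
  using chart by (simp add: is_chart_def)

lemma param_coord: "p \<in> chart_dom x \<Longrightarrow> param x (coord x p) = p"
  using chart by (simp add: is_chart_def homeomorphism_def)

lemma param_in_dom: "y \<in> coord x ` chart_dom x \<Longrightarrow> param x y \<in> chart_dom x"
  using param_coord by auto

lemma coord_param: "y \<in> coord x ` chart_dom x \<Longrightarrow> coord x (param x y) = y"
  using param_coord by auto

lemma has_chart_derivative:
  "smooth_in_chart x f \<Longrightarrow> p \<in> chart_dom x \<Longrightarrow>
    ((\<lambda>y. f (param x y)) has_derivative chart_derivative x f p) (at (coord x p))"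
  unfolding chart_derivative_def smooth_in_chart_iff
  by (rule smooth_on_has_derivative[OF open_chart_image]) auto

lemma bounded_linear_chart_derivative:
  "smooth_in_chart x f \<Longrightarrow> p \<in> chart_dom x \<Longrightarrow> bounded_linear (chart_derivative x f p)"
  using has_chart_derivative by (rule has_derivative_bounded_linear)

lemma has_derivative_chart_cong:
  assumes "((\<lambda>y. f (param x y)) has_derivative D) (at (coord x p))" "p \<in> chart_dom x"
    and "\<And>q. q \<in> chart_dom x \<Longrightarrow> f q = f' q"
  shows "((\<lambda>y. f' (param x y)) has_derivative D) (at (coord x p))"
  by (rule has_derivative_transform_within_open[OF assms(1) open_chart_image])
    (use assms param_in_dom in auto)

lemma smooth_in_chart_cong:
  assumes "\<And>q. q \<in> chart_dom x \<Longrightarrow> f q = f' q"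
  shows "smooth_in_chart x f \<longleftrightarrow> smooth_in_chart x f'"
  unfolding smooth_in_chart_iff
  by (rule smooth_on_cong[OF open_chart_image]) (use assms param_in_dom in auto)

lemma chart_derivative_cong:
  assumes "p \<in> chart_dom x" "\<And>q. q \<in> chart_dom x \<Longrightarrow> f q = f' q"
  shows "chart_derivative x f p = chart_derivative x f' p"
  unfolding chart_derivative_def
  by (rule frechet_derivative_cong_open[OF open_chart_image]) (use assms param_in_dom in auto)

lemma pderiv_chart_nth:
  assumes "smooth_in_chart x W" "p \<in> chart_dom x"
  shows "pderiv_chart x i (\<lambda>q. W q $ k) p = chart_derivative x W p (axis i 1) $ k"
  unfolding pderiv_chart_eq
  by (subst chart_derivativeI[OF bounded_linear.has_derivative[OF bounded_linear_vec_nth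
          has_chart_derivative[OF assms]]]) simp

lemma differential_eq_chart_derivative:
  assumes "smooth_in_chart x f" "p \<in> chart_dom x"
  shows "differential f x p \<bullet> v = chart_derivative x f p v"
proof -
  interpret bounded_linear "chart_derivative x f p"
    by (rule bounded_linear_chart_derivative[OF assms])
  have "chart_derivative x f p v = chart_derivative x f p (\<Sum>i\<in>UNIV. v $ i *\<^sub>R axis i 1)"
    using basis_expansion[of v] by (simp add: scalar_mult_eq_scaleR)
  then show ?thesis
    by (simp add: sum scaleR inner_vec_def differential_def pderiv_chart_eq mult.commute)
qed

lemma smooth_differential:
  assumes "smooth_in_chart x f"
  shows "smooth_in_chart x (differential f x)"
  unfolding smooth_in_chart_iff
proof (rule smooth_on_vec[OF open_chart_image])
  fix i
  have "smooth_on (coord x ` chart_dom x)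
    (\<lambda>y. frechet_derivative (\<lambda>y. f (param x y)) (at y) (axis i 1))"
    using assms smooth_on_frechet_derivative[OF open_chart_image]
    unfolding smooth_in_chart_iff by blast
  then show "smooth_on (coord x ` chart_dom x) (\<lambda>y. differential f x (param x y) $ i)"
    using smooth_on_cong[OF open_chart_image,
        of "\<lambda>y. differential f x (param x y) $ i"
          "\<lambda>y. frechet_derivative (\<lambda>y. f (param x y)) (at y) (axis i 1)"]
    by (simp add: differential_def pderiv_chart_def o_def coord_param)
qed

text \<open>Pairing the component vector of \<open>d\<phi>\<close> with a fixed \<open>w\<close>
  gives the directional derivative along \<open>w\<close>, so both sides are mixed second
  derivatives of the same function.\<close>

lemma chart_derivative_differential_symmetric:
  assumes f: "smooth_in_chart x f" and p: "p \<in> chart_dom x"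
  shows "w \<bullet> chart_derivative x (differential f x) p v = v \<bullet> chart_derivative x (differential f x) p w"
proof -
  define F where "F = (\<lambda>y. f (param x y))"
  let ?S = "coord x ` chart_dom x"
  have *: "w \<bullet> chart_derivative x (differential f x) p v =
      frechet_derivative (\<lambda>y. frechet_derivative F (at y) w) (at (coord x p)) v" for v w
  proof -
    have "((\<lambda>y. w \<bullet> differential f x (param x y)) has_derivative
        (\<lambda>h. w \<bullet> chart_derivative x (differential f x) p h)) (at (coord x p))"
      by (rule has_derivative_inner_right[OF has_chart_derivative[OF smooth_differential[OF f] p]])
    then have "((\<lambda>y. frechet_derivative F (at y) w) has_derivative
        (\<lambda>h. w \<bullet> chart_derivative x (differential f x) p h)) (at (coord x p))"
    proof (rule has_derivative_transform_within_open[OF _ open_chart_image])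
      fix y assume y: "y \<in> ?S"
      show "w \<bullet> differential f x (param x y) = frechet_derivative F (at y) w"
        using differential_eq_chart_derivative[OF f param_in_dom[OF y], of w]
        by (simp add: inner_commute chart_derivative_def F_def coord_param[OF y])
    qed (use p in simp)
    then show ?thesis
      by (simp add: frechet_derivative_at[symmetric])
  qed
  show ?thesis
    unfolding * using f p unfolding smooth_in_chart_iff F_def
    by (intro smooth_second_derivative_symmetric[OF open_chart_image]) auto
qed

end

section \<open>Metric and Levi-Civita connection in a single chart\<close>

locale riemannian_chart =
  fixes x :: "('a::topological_space, 'n::finite) chart" and g :: "('a, 'n) metric_components"
  assumes chart: "is_chart x"
    and smooth_metric: "smooth_in_chart x (g x)"
    and symmetric: "p \<in> chart_dom x \<Longrightarrow> transpose (g x p) = g x p"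
    and positive: "p \<in> chart_dom x \<Longrightarrow> v \<noteq> 0 \<Longrightarrow> v \<bullet> (g x p *v v) > 0"
begin

lemma invertible_metric:
  assumes "p \<in> chart_dom x" shows "invertible (g x p)"
proof -
  have "v = 0" if "g x p *v v = 0" for v
    using positive[OF assms, of v] that by force
  then show ?thesis
    unfolding invertible_left_inverse matrix_left_invertible_ker by blast
qed

lemmas metric_inv = matrix_inv_vector_mult[OF invertible_metric]

lemma metric_commute: "p \<in> chart_dom x \<Longrightarrow> v \<bullet> (g x p *v w) = w \<bullet> (g x p *v v)"
  by (metis symmetric dot_lmul_matrix inner_commute transpose_matrix_vector)

lemma smooth_inverse_metric: "smooth_in_chart x (\<lambda>p. matrix_inv (g x p))"
  using smooth_metric invertible_metric param_in_dom[OF chart] unfolding smooth_in_chart_iff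
  by (intro smooth_on_matrix_inv open_chart_image[OF chart]) (auto simp: invertible_det_nz)

text \<open>Both sides are derivatives of the same function by \<open>metric_commute\<close>, and
  derivatives are unique.\<close>

lemma metric_derivative_commute:
  assumes p: "p \<in> chart_dom x"
  shows "v \<bullet> (chart_derivative x (g x) p h *v w) = w \<bullet> (chart_derivative x (g x) p h *v v)"
proof -
  have *: "((\<lambda>y. v \<bullet> (g x (param x y) *v w)) has_derivative
     (\<lambda>h. v \<bullet> (chart_derivative x (g x) p h *v w))) (at (coord x p))" for v w
    by (intro has_derivative_inner_right bounded_linear.has_derivative[OF
        bounded_bilinear.bounded_linear_left[OF bounded_bilinear_matrix_vector_mult]]
        has_chart_derivative[OF chart smooth_metric p])
  have "((\<lambda>y. w \<bullet> (g x (param x y) *v v)) has_derivative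
     (\<lambda>h. v \<bullet> (chart_derivative x (g x) p h *v w))) (at (coord x p))"
    by (rule has_derivative_chart_cong[OF chart *[of v w] p]) (rule metric_commute)
  from has_derivative_unique[OF this *] show ?thesis by meson
qed

lemma has_derivative_lower:
  assumes "smooth_in_chart x X" and p: "p \<in> chart_dom x"
  shows "((\<lambda>y. g x (param x y) *v X (param x y)) has_derivative
    (\<lambda>h. g x p *v chart_derivative x X p h + chart_derivative x (g x) p h *v X p)) (at (coord x p))"
  using bounded_bilinear.FDERIV[OF bounded_bilinear_matrix_vector_mult
      has_chart_derivative[OF chart smooth_metric p] has_chart_derivative[OF chart assms]]
  by (simp add: param_coord[OF chart p])

lemma smooth_lower: "smooth_in_chart x X \<Longrightarrow> smooth_in_chart x (\<lambda>p. g x p *v X p)"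
  using smooth_metric unfolding smooth_in_chart_iff
  by (intro smooth_on_bounded_bilinear[OF _ bounded_bilinear_matrix_vector_mult] open_chart_image[OF chart])

lemma smooth_raise: "smooth_in_chart x u \<Longrightarrow> smooth_in_chart x (\<lambda>p. matrix_inv (g x p) *v u p)"
  using smooth_inverse_metric unfolding smooth_in_chart_iff
  by (intro smooth_on_bounded_bilinear[OF _ bounded_bilinear_matrix_vector_mult] open_chart_image[OF chart])

text \<open>This is \<open>g(D\<^sub>v X, w)\<close>, with the Christoffel symbols expanded so that \<open>g\<^sup>-\<^sup>1\<close> drops out.\<close>

definition covariant_form :: "('a \<Rightarrow> real ^ 'n) \<Rightarrow> 'a \<Rightarrow> real ^ 'n \<Rightarrow> real ^ 'n \<Rightarrow> real" where
  "covariant_form X p v w = w \<bullet> (g x p *v chart_derivative x X p v) +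
     (w \<bullet> (chart_derivative x (g x) p v *v X p) + v \<bullet> (chart_derivative x (g x) p (X p) *v w)
      - v \<bullet> (chart_derivative x (g x) p w *v X p)) / 2"

lemma bilinear_covariant_form:
  assumes "smooth_in_chart x X" "p \<in> chart_dom x"
  shows "bilinear (covariant_form X p)"
proof -
  interpret D: bounded_linear "chart_derivative x X p"
    by (rule bounded_linear_chart_derivative[OF chart assms])
  interpret G: bounded_linear "chart_derivative x (g x) p"
    by (rule bounded_linear_chart_derivative[OF chart smooth_metric assms(2)])
  show ?thesis
    unfolding bilinear_def covariant_form_def
    by (auto intro!: linearI simp: D.add D.scaleR G.add G.scaleR algebra_simps inner_add_left
        inner_add_right scaleR_matrix_vector_assoc[symmetric] add_divide_distrib diff_divide_distrib)
qed

text \<open>Each Christoffel symbol is a component of \<open>H *v t j\<close>, halved. Lowering the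
  index by \<open>G\<close> undoes \<open>H\<close> and leaves the three metric derivatives of the
  Koszul formula.\<close>

lemma covariant_form_axis:
  assumes X: "smooth_in_chart x (X x)" and p: "p \<in> chart_dom x"
  shows "covariant_form (X x) p (axis i 1) (axis m 1) =
    (g x p *v (\<chi> k. covariant_derivative g X x p i k)) $ m"
proof -
  define G where "G = g x p"
  define H where "H = matrix_inv G"
  define d where "d i = chart_derivative x (g x) p (axis i 1)" for i
  \<comment> \<open>Twice the Christoffel symbols of the first kind, for the fixed lower index
    \<open>i\<close>.\<close>
  define t where "t j = (\<chi> l. d i $ j $ l + d j $ i $ l - d l $ i $ j)" for j
  interpret L: bounded_linear "chart_derivative x (g x) p"
    by (rule bounded_linear_chart_derivative[OF chart smooth_metric p])
  have sm: "smooth_in_chart x (\<lambda>q. g x q $ j)" for j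
    using smooth_metric smooth_on_nth[OF open_chart_image[OF chart]]
    unfolding smooth_in_chart_iff by blast
  have row: "chart_derivative x (\<lambda>q. g x q $ j) p h = chart_derivative x (g x) p h $ j" for h j
    by (subst chart_derivativeI[OF bounded_linear.has_derivative[OF bounded_linear_vec_nth
          has_chart_derivative[OF chart smooth_metric p]]]) simp
  have pd: "pderiv_chart x k (\<lambda>q. g x q $ a $ b) p = d k $ a $ b" for k a b
    using pderiv_chart_nth[OF chart sm p] by (simp add: row d_def)
  have chr: "christoffel g x p k i j = (H *v t j) $ k / 2" for k j
    by (simp add: christoffel_def pd H_def G_def t_def matrix_vector_mult_def)
  have dsym: "d k $ a $ b = d k $ b $ a" for k a b
    using metric_derivative_commute[OF p, of "axis a 1" "axis k 1" "axis b 1"]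
    by (simp add: d_def inner_axis' matrix_vector_mul_component inner_axis)
  have cov: "(\<chi> k. covariant_derivative g X x p i k) =
     chart_derivative x (X x) p (axis i 1) + (1/2) *\<^sub>R (\<Sum>j\<in>UNIV. X x p $ j *\<^sub>R (H *v t j))"
    by (simp add: vec_eq_iff covariant_derivative_def chr pderiv_chart_nth[OF chart X p]
        sum_distrib_left sum_divide_distrib mult.commute)
  have "G *v (\<Sum>j\<in>UNIV. X x p $ j *\<^sub>R (H *v t j)) = (\<Sum>j\<in>UNIV. X x p $ j *\<^sub>R t j)"
    by (simp add: linear_sum[OF matrix_vector_mul_linear] o_def matrix_vector_mult_scaleR
        metric_inv[OF p] G_def H_def)
  then have "(G *v (\<chi> k. covariant_derivative g X x p i k)) $ m =
      (G *v chart_derivative x (X x) p (axis i 1)) $ m + (\<Sum>j\<in>UNIV. X x p $ j * t j $ m) / 2"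
    unfolding cov by (simp add: algebra_simps)
  moreover have "(\<Sum>j\<in>UNIV. X x p $ j * t j $ m) =
     axis m 1 \<bullet> (d i *v X x p) + axis i 1 \<bullet> (chart_derivative x (g x) p (X x p) *v axis m 1)
      - axis i 1 \<bullet> (d m *v X x p)"
  proof -
    have entry: "axis k 1 \<bullet> (M *v z) = (\<Sum>j\<in>UNIV. z $ j * M $ k $ j)" for k z and M :: "real ^ 'n ^ 'n"
      by (simp add: inner_axis' matrix_vector_mult_def mult.commute)
    have "X x p = (\<Sum>j\<in>UNIV. X x p $ j *\<^sub>R axis j 1)"
      using basis_expansion[of "X x p"] by (simp add: scalar_mult_eq_scaleR)
    then have "chart_derivative x (g x) p (X x p) = (\<Sum>j\<in>UNIV. X x p $ j *\<^sub>R d j)"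
      by (metis (no_types, lifting) L.scaleR L.sum d_def sum.cong)
    then have "axis i 1 \<bullet> (chart_derivative x (g x) p (X x p) *v axis m 1) = (\<Sum>j\<in>UNIV. X x p $ j * d j $ i $ m)"
      by (simp add: inner_axis' matrix_vector_mul_component inner_axis)
    moreover have "axis m 1 \<bullet> (d i *v X x p) = (\<Sum>j\<in>UNIV. X x p $ j * d i $ j $ m)"
      by (simp add: entry dsym[of i m])
    moreover have "axis i 1 \<bullet> (d m *v X x p) = (\<Sum>j\<in>UNIV. X x p $ j * d m $ i $ j)"
      by (rule entry)
    ultimately show ?thesis
      by (simp add: t_def algebra_simps sum.distrib sum_subtractf)
  qed
  ultimately show ?thesis
    by (simp add: covariant_form_def G_def d_def inner_axis')
qed

text \<open>The lowered form is bilinear, hence determined by its values on basis vectors, and the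
  invertibility of the metric allows passing back to the raised components.\<close>

lemma covariant_derivative_zero_iff:
  assumes X: "smooth_in_chart x (X x)" and p: "p \<in> chart_dom x"
  shows "(\<forall>i k. covariant_derivative g X x p i k = 0) \<longleftrightarrow> (\<forall>v w. covariant_form (X x) p v w = 0)"
proof
  assume 0: "\<forall>i k. covariant_derivative g X x p i k = 0"
  have "(\<chi> k. covariant_derivative g X x p i k) = 0" for i
    using 0 by (simp add: vec_eq_iff)
  then have "covariant_form (X x) p a b = 0" if "a \<in> Basis" "b \<in> Basis" for a b
    using that covariant_form_axis[where X = X, OF X p] by (auto simp: Basis_vec_def)
  then have "covariant_form (X x) p = (\<lambda>v w. 0)"
    by (intro bilinear_eq_stdbasis bilinear_covariant_form X p) (auto simp: bilinear_def intro!: linearI)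
  then show "\<forall>v w. covariant_form (X x) p v w = 0" by simp
next
  assume "\<forall>v w. covariant_form (X x) p v w = 0"
  then have "g x p *v (\<chi> k. covariant_derivative g X x p i k) = 0" for i
    using covariant_form_axis[where X = X, OF X p] by (simp add: vec_eq_iff)
  then have "(\<chi> k. covariant_derivative g X x p i k) = 0" for i
    using metric_inv(2)[OF p] by (metis matrix_vector_mult_0_right)
  then show "\<forall>i k. covariant_derivative g X x p i k = 0"
    by (simp add: vec_eq_iff)
qed

text \<open>No derivative of a matrix inverse is computed. With \<open>w\<close> the raised
  \<open>\<eta>\<close>, differentiating \<open>g w = \<eta>\<close> determines \<open>w'\<close>,
  and the derivative of the metric enters with a minus sign.\<close>

lemma has_derivative_coinner:
  assumes \<zeta>: "smooth_in_chart x \<zeta>" and \<eta>: "smooth_in_chart x \<eta>" and p: "p \<in> chart_dom x"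
  shows "((\<lambda>y. coinner g x (param x y) (\<zeta> (param x y)) (\<eta> (param x y))) has_derivative
    (\<lambda>h. chart_derivative x \<zeta> p h \<bullet> (matrix_inv (g x p) *v \<eta> p) +
         (matrix_inv (g x p) *v \<zeta> p) \<bullet> chart_derivative x \<eta> p h -
         (matrix_inv (g x p) *v \<zeta> p) \<bullet>
           (chart_derivative x (g x) p h *v (matrix_inv (g x p) *v \<eta> p)))) (at (coord x p))"
proof -
  define w where "w = (\<lambda>p. matrix_inv (g x p) *v \<eta> p)"
  have w: "smooth_in_chart x w" unfolding w_def by (rule smooth_raise[OF \<eta>])
  have "((\<lambda>y. \<eta> (param x y)) has_derivative
     (\<lambda>h. g x p *v chart_derivative x w p h + chart_derivative x (g x) p h *v w p)) (at (coord x p))"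
    by (rule has_derivative_chart_cong[OF chart has_derivative_lower[OF w p] p])
      (simp add: w_def metric_inv)
  then have w': "chart_derivative x \<eta> p h = g x p *v chart_derivative x w p h + chart_derivative x (g x) p h *v w p" for h
    by (simp add: chart_derivativeI)
  have "((\<lambda>y. \<zeta> (param x y) \<bullet> w (param x y)) has_derivative
     (\<lambda>h. \<zeta> p \<bullet> chart_derivative x w p h + chart_derivative x \<zeta> p h \<bullet> w p)) (at (coord x p))"
    using has_derivative_inner[OF has_chart_derivative[OF chart \<zeta> p] has_chart_derivative[OF chart w p]]
    by (simp add: param_coord[OF chart p])
  moreover have "\<zeta> p \<bullet> u = (matrix_inv (g x p) *v \<zeta> p) \<bullet> (g x p *v u)" for u
    using metric_commute[OF p, of "matrix_inv (g x p) *v \<zeta> p" u] metric_inv(1)[OF p]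
    by (simp add: inner_commute)
  ultimately show ?thesis
    unfolding coinner_def w'
    by (simp add: w_def inner_add_right algebra_simps)
qed

section \<open>Gradient, Hessian and Poisson bracket\<close>

definition gradient :: "('a \<Rightarrow> real) \<Rightarrow> 'a \<Rightarrow> real ^ 'n" where
  "gradient \<phi> p = matrix_inv (g x p) *v differential \<phi> x p"

text \<open>This is \<open>D\<^sup>2\<phi>(v, v)\<close>: the coordinate Hessian minus the
  Christoffel term paired with \<open>d\<phi>\<close>. It uses derivatives of the differential
  rather than of the gradient because the bracket produces them in that shape.\<close>

definition hessian_form :: "('a \<Rightarrow> real) \<Rightarrow> 'a \<Rightarrow> real ^ 'n \<Rightarrow> real" where
  "hessian_form \<phi> p v = v \<bullet> chart_derivative x (differential \<phi> x) p v
     - v \<bullet> (chart_derivative x (g x) p v *v gradient \<phi> p)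
     + v \<bullet> (chart_derivative x (g x) p (gradient \<phi> p) *v v) / 2"

lemma smooth_gradient: "smooth_in_chart x \<phi> \<Longrightarrow> smooth_in_chart x (gradient \<phi>)"
  unfolding gradient_def by (intro smooth_raise smooth_differential chart)

lemma lower_gradient: "p \<in> chart_dom x \<Longrightarrow> g x p *v gradient \<phi> p = differential \<phi> x p"
  by (simp add: gradient_def metric_inv)

lemma derivative_differential_gradient:
  assumes "smooth_in_chart x \<phi>" "p \<in> chart_dom x"
  shows "chart_derivative x (differential \<phi> x) p h =
    g x p *v chart_derivative x (gradient \<phi>) p h + chart_derivative x (g x) p h *v gradient \<phi> p"
  by (subst chart_derivativeI[OF has_derivative_chart_cong[OF chart
          has_derivative_lower[OF smooth_gradient[OF assms(1)] assms(2)] assms(2) lower_gradient]]) simp_all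

lemma hessian_form_eq_covariant_form:
  assumes "smooth_in_chart x \<phi>" "p \<in> chart_dom x"
  shows "hessian_form \<phi> p v = covariant_form (gradient \<phi>) p v v"
  by (simp add: hessian_form_def covariant_form_def derivative_differential_gradient[OF assms]
      inner_add_right)

text \<open>Substituting the derivative of \<open>d\<phi>\<close> for that of the gradient leaves
  the coordinate Hessian, which is symmetric, and Christoffel terms that are symmetric because the
  connection is torsion free.\<close>

lemma covariant_form_gradient_symmetric:
  assumes "smooth_in_chart x \<phi>" and p: "p \<in> chart_dom x"
  shows "covariant_form (gradient \<phi>) p v w = covariant_form (gradient \<phi>) p w v"
  using chart_derivative_differential_symmetric[OF chart assms, of v w]
    metric_derivative_commute[OF p, of v "gradient \<phi> p" w]
  by (simp add: covariant_form_def derivative_differential_gradient[OF assms] inner_add_right) argo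

lemma coinner_lower:
  assumes "p \<in> chart_dom x"
  shows "coinner g x p (g x p *v v) (g x p *v w) = v \<bullet> (g x p *v w)"
  using metric_commute[OF assms, of w v]
  by (simp add: coinner_def metric_inv[OF assms] inner_commute)

lemma carleman_symbol_lower:
  assumes "p \<in> chart_dom x"
  shows "carleman_symbol g \<phi> x p (g x p *v v) =
    Complex (v \<bullet> (g x p *v v) - gradient \<phi> p \<bullet> (g x p *v gradient \<phi> p))
      (2 * (v \<bullet> (g x p *v gradient \<phi> p)))"
  by (simp add: carleman_symbol_def lower_gradient[OF assms, symmetric] coinner_lower[OF assms]
      complex_eq_iff)

text \<open>Write the symbol as \<open>\<alpha> + 2 i \<beta>\<close> with
  \<open>\<alpha> = |\<xi>|\<^sup>2 - |d\<phi>|\<^sup>2\<close> and \<open>\<beta>\<close> the inner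
  product of \<open>\<xi>\<close> and \<open>d\<phi>\<close>. Bilinearity and antisymmetry give
  \<open>4 i\<close> times the bracket of \<open>\<alpha>\<close> and \<open>\<beta>\<close>. That
  bracket is \<open>2 b v - a X\<close>, twice the sum of the two Hessian values, whence the factor
  8.\<close>

lemma poisson_bracket_carleman_symbol:
  assumes \<phi>: "smooth_in_chart x \<phi>" and p: "p \<in> chart_dom x"
  shows "poisson_bracket x (\<lambda>q \<eta>. cnj (carleman_symbol g \<phi> x q \<eta>)) (carleman_symbol g \<phi> x) p (g x p *v v)
    = 8 * \<i> * of_real (hessian_form \<phi> p v + hessian_form \<phi> p (gradient \<phi> p))"
proof -
  define X where "X = gradient \<phi> p"
  define \<xi> where "\<xi> = g x p *v v"
  define \<Phi> where "\<Phi> = chart_derivative x (differential \<phi> x) p"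
  define d where "d = chart_derivative x (g x) p"
  \<comment> \<open>The base derivatives of \<open>\<alpha>\<close> and \<open>\<beta>\<close> at
    fixed \<open>\<xi>\<close>. Although \<open>\<xi>\<close> is constant, its raised vector varies
    with the metric, which explains the term in \<open>v\<close> alone.\<close>
  define a b where "a h = - (v \<bullet> (d h *v v)) - 2 * (X \<bullet> \<Phi> h) + X \<bullet> (d h *v X)"
    and "b h = v \<bullet> \<Phi> h - v \<bullet> (d h *v X)" for h
  interpret F: bounded_linear \<Phi>
    unfolding \<Phi>_def by (rule bounded_linear_chart_derivative[OF chart smooth_differential[OF chart \<phi>] p])
  interpret d: bounded_linear d
    unfolding d_def by (rule bounded_linear_chart_derivative[OF chart smooth_metric p])
  have Hu: "matrix_inv (g x p) *v differential \<phi> x p = X" and H\<xi>: "matrix_inv (g x p) *v \<xi> = v"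
    by (simp_all add: X_def \<xi>_def gradient_def metric_inv[OF p])
  have const: "smooth_in_chart x (\<lambda>q. \<xi>)" "chart_derivative x (\<lambda>q. \<xi>) p = (\<lambda>h. 0)"
    by (auto simp: smooth_in_chart_iff smooth_on_const[OF open_chart_image[OF chart]] chart_derivative_def
        frechet_derivative_const)
  note u = smooth_differential[OF chart \<phi>]
  have base: "((\<lambda>y. carleman_symbol g \<phi> x (param x y) \<xi>) has_derivative
      (\<lambda>h. of_real (a h) + 2 * \<i> * of_real (b h))) (at (coord x p))"
    unfolding carleman_symbol_def
    by (rule has_derivative_eq_rhs, (rule derivative_intros has_derivative_coinner[OF _ _ p] const u)+)
      (simp add: const Hu H\<xi> a_def b_def \<Phi>_def[symmetric] d_def[symmetric] inner_commute algebra_simps fun_eq_iff)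
  have fibre: "(carleman_symbol g \<phi> x p has_derivative
      (\<lambda>h. of_real (2 * (v \<bullet> h)) + 2 * \<i> * of_real (X \<bullet> h))) (at \<xi>)"
  proof -
    have "\<xi> \<bullet> (matrix_inv (g x p) *v h) = v \<bullet> h" for h
      using metric_commute[OF p, of "matrix_inv (g x p) *v h" v]
      by (simp add: \<xi>_def metric_inv[OF p] inner_commute)
    then show ?thesis
      unfolding carleman_symbol_def coinner_def
      by (auto intro!: derivative_eq_intros bounded_linear.has_derivative[OF matrix_vector_mul_bounded_linear]
          simp: H\<xi> Hu inner_commute fun_eq_iff)
  qed
  have cnj_d: "((\<lambda>z. cnj (f z)) has_derivative (\<lambda>h. cnj (f' h))) F"
    if "(f has_derivative f') F" for f :: "real ^ 'n \<Rightarrow> complex" and f' F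
    by (rule bounded_linear.has_derivative[OF bounded_linear_cnj that])
  \<comment> \<open>The fibre derivatives of \<open>\<alpha>\<close> and \<open>\<beta>\<close> have
    components \<open>2 v\<close> and \<open>X\<close>, so the coordinate sum of the bracket
    evaluates the linear maps \<open>b\<close> and \<open>a\<close> at these vectors.\<close>
  have lin: "(\<Sum>j\<in>UNIV. z $ j * f (axis j 1)) = f z" if "bounded_linear f" for f :: "real ^ 'n \<Rightarrow> real" and z
  proof -
    interpret bounded_linear f by fact
    have "f z = f (\<Sum>i\<in>UNIV. z $ i *\<^sub>R axis i 1)"
      using basis_expansion[of z] by (simp add: scalar_mult_eq_scaleR)
    then show ?thesis by (simp add: sum scaleR)
  qed
  have ab: "bounded_linear a" "bounded_linear b"
    unfolding a_def b_def linear_conv_bounded_linear[symmetric]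
    by (auto intro!: linearI simp: F.add F.scaleR d.add d.scaleR inner_add_right algebra_simps
        scaleR_matrix_vector_assoc[symmetric])
  have "poisson_bracket x (\<lambda>q \<eta>. cnj (carleman_symbol g \<phi> x q \<eta>)) (carleman_symbol g \<phi> x) p \<xi>
    = (\<Sum>j\<in>UNIV. 4 * \<i> * of_real (2 * (v $ j * b (axis j 1)) - X $ j * a (axis j 1)))"
    unfolding poisson_bracket_def pderiv_chart_eq
      chart_derivativeI[where f = "\<lambda>q. carleman_symbol g \<phi> x q \<xi>", OF base]
      chart_derivativeI[where f = "\<lambda>q. cnj (carleman_symbol g \<phi> x q \<xi>)", OF cnj_d[OF base]]
      frechet_derivative_at[OF fibre, symmetric] frechet_derivative_at[OF cnj_d[OF fibre], symmetric]
    by (intro sum.cong refl) (simp add: inner_axis algebra_simps complex_eq_iff)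
  also have "\<dots> = 4 * \<i> * of_real (2 * b v - a X)"
    using lin[OF ab(1), of X] lin[OF ab(2), of v]
    by (simp add: sum_distrib_left[symmetric] sum_subtractf of_real_sum[symmetric] del: of_real_sum of_real_diff of_real_mult)
  also have "\<dots> = 8 * \<i> * of_real (hessian_form \<phi> p v + hessian_form \<phi> p X)"
    by (simp add: a_def b_def hessian_form_def X_def[symmetric] \<Phi>_def[symmetric] d_def[symmetric] complex_eq_iff)
  finally show ?thesis by (simp add: \<xi>_def X_def)
qed

end

subsection \<open>Conformal changes and Carleman weights\<close>

context riemannian_chart
begin

text \<open>Stated for vectors instead of covectors. The two premises are the imaginary and the real
  part of the equation that the symbol vanishes.\<close>

definition carleman_condition :: "('a \<Rightarrow> real) \<Rightarrow> 'a \<Rightarrow> bool" where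
  "carleman_condition \<phi> p \<longleftrightarrow>
     (\<forall>v. v \<bullet> (g x p *v gradient \<phi> p) = 0 \<and>
          v \<bullet> (g x p *v v) = gradient \<phi> p \<bullet> (g x p *v gradient \<phi> p) \<longrightarrow>
        hessian_form \<phi> p v + hessian_form \<phi> p (gradient \<phi> p) = 0)"

lemma carleman_condition_iff:
  assumes "smooth_in_chart x \<phi>" and p: "p \<in> chart_dom x"
  shows "carleman_condition \<phi> p \<longleftrightarrow>
    (\<forall>\<xi>. carleman_symbol g \<phi> x p \<xi> = 0 \<longrightarrow>
        poisson_bracket x (\<lambda>q \<eta>. cnj (carleman_symbol g \<phi> x q \<eta>)) (carleman_symbol g \<phi> x) p \<xi> = 0)"
    (is "_ \<longleftrightarrow> (\<forall>\<xi>. ?Z \<xi>)")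
proof -
  have "(\<forall>\<xi>. ?Z \<xi>) \<longleftrightarrow> (\<forall>v. ?Z (g x p *v v))"
    by (metis metric_inv(1)[OF p])
  also have "\<dots> \<longleftrightarrow> carleman_condition \<phi> p"
    unfolding carleman_condition_def poisson_bracket_carleman_symbol[OF assms] carleman_symbol_lower[OF p]
    by (auto simp: complex_eq_iff)
  finally show ?thesis by blast
qed

lemma unit_gradient_covariant_form:
  assumes \<phi>: "smooth_in_chart x \<phi>" and p: "p \<in> chart_dom x"
    and unit: "\<And>q. q \<in> chart_dom x \<Longrightarrow> gradient \<phi> q \<bullet> (g x q *v gradient \<phi> q) = 1"
    and carleman: "carleman_condition \<phi> p"
  shows "covariant_form (gradient \<phi>) p v w = 0"
proof -
  define X where "X = gradient \<phi> p"
  define B where "B = covariant_form (gradient \<phi>) p"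
  note sm = smooth_gradient[OF \<phi>]
  have bil: "bilinear B" unfolding B_def by (rule bilinear_covariant_form[OF sm p])
  have sym: "B v w = B w v" for v w
    unfolding B_def by (rule covariant_form_gradient_symmetric[OF \<phi> p])
  \<comment> \<open>Half the derivative of the constant function \<open>|X|\<^sup>2 = 1\<close> in
    direction \<open>v\<close>.\<close>
  have BX: "B v X = 0" for v
  proof -
    have d1: "((\<lambda>y. gradient \<phi> (param x y) \<bullet> (g x (param x y) *v gradient \<phi> (param x y))) has_derivative
      (\<lambda>h. X \<bullet> (g x p *v chart_derivative x (gradient \<phi>) p h + chart_derivative x (g x) p h *v X)
         + chart_derivative x (gradient \<phi>) p h \<bullet> (g x p *v X))) (at (coord x p))"
      using has_derivative_inner[OF has_chart_derivative[OF chart sm p] has_derivative_lower[OF sm p]]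
      by (simp add: param_coord[OF chart p] X_def)
    have d2: "((\<lambda>y. gradient \<phi> (param x y) \<bullet> (g x (param x y) *v gradient \<phi> (param x y)))
        has_derivative (\<lambda>h. 0)) (at (coord x p))"
      by (rule has_derivative_chart_cong[OF chart _ p, of "\<lambda>q. 1"]) (simp_all add: unit)
    have "X \<bullet> (g x p *v chart_derivative x (gradient \<phi>) p v + chart_derivative x (g x) p v *v X)
         + chart_derivative x (gradient \<phi>) p v \<bullet> (g x p *v X) = 0"
      using fun_cong[OF has_derivative_unique[OF d1 d2], of v] by simp
    then show ?thesis
      using metric_commute[OF p, of "chart_derivative x (gradient \<phi>) p v" X]
      by (simp add: B_def covariant_form_def X_def[symmetric] inner_add_right)
  qed
  \<comment> \<open>Scaled to unit length, a nonzero \<open>z\<close> orthogonal to \<open>X\<close>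
    satisfies the premises of the Carleman condition. \<open>B X X = 0\<close> removes the second
    summand, and homogeneity undoes the scaling.\<close>
  have perp: "B z z = 0" if z: "z \<bullet> (g x p *v X) = 0" for z
  proof (cases "z = 0")
    case True
    then show ?thesis by (simp add: bilinear_lzero[OF bil])
  next
    case False
    define s where "s = 1 / sqrt (z \<bullet> (g x p *v z))"
    have pos: "z \<bullet> (g x p *v z) > 0" by (rule positive[OF p False])
    then have "s * s * (z \<bullet> (g x p *v z)) = 1" by (simp add: s_def)
    then have "B (s *\<^sub>R z) (s *\<^sub>R z) + B X X = 0"
      using carleman z unit[OF p]
      unfolding carleman_condition_def hessian_form_eq_covariant_form[OF \<phi> p] B_def[symmetric]
      by (simp add: X_def[symmetric] matrix_vector_mult_scaleR mult.assoc)
    then show ?thesis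
      using pos BX by (simp add: bilinear_lmul[OF bil] bilinear_rmul[OF bil] s_def)
  qed
  have diag: "B w w = 0" for w
  proof -
    \<comment> \<open>The component of \<open>w\<close> orthogonal to the unit vector
      \<open>X\<close>; by \<open>BX\<close> and symmetry the removed part contributes
      nothing.\<close>
    define z where "z = w - (w \<bullet> (g x p *v X)) *\<^sub>R X"
    have "z \<bullet> (g x p *v X) = 0"
      using unit[OF p] by (simp add: z_def inner_diff_left X_def)
    moreover have "B z z = B w w"
      using BX sym[of X w] by (simp add: z_def bilinear_lsub[OF bil] bilinear_rsub[OF bil] bilinear_lmul[OF bil] bilinear_rmul[OF bil])
    ultimately show ?thesis using perp[of z] by simp
  qed
  \<comment> \<open>Polarisation of the symmetric form \<open>B\<close>.\<close>
  have "B v w = 0"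
    using diag[of "v + w"] diag[of v] diag[of w] sym[of v w]
    by (simp add: bilinear_ladd[OF bil] bilinear_radd[OF bil])
  then show ?thesis by (simp add: B_def)
qed

lemma hessian_form_scaleR:
  assumes "smooth_in_chart x \<phi>" "p \<in> chart_dom x"
  shows "hessian_form \<phi> p (r *\<^sub>R v) = r\<^sup>2 * hessian_form \<phi> p v"
  unfolding hessian_form_eq_covariant_form[OF assms]
  using bilinear_covariant_form[OF smooth_gradient[OF assms(1)] assms(2)]
  by (simp only: bilinear_lmul bilinear_rmul power2_eq_square) simp

section \<open>Gradient and Hessian under a conformal change\<close>

context
  fixes c :: "'a \<Rightarrow> real"
  assumes c: "smooth_in_chart x c" and c_pos: "\<And>p. p \<in> chart_dom x \<Longrightarrow> c p > 0"
begin

lemma conformal_chart: "riemannian_chart x (conformal_metric c g)"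
proof
  show "smooth_in_chart x (conformal_metric c g x)"
    using c smooth_metric unfolding smooth_in_chart_iff conformal_metric_def
    by (intro smooth_on_bounded_bilinear[OF _ bounded_bilinear_scaleR] open_chart_image[OF chart])
  show "transpose (conformal_metric c g x p) = conformal_metric c g x p" if "p \<in> chart_dom x" for p
    using symmetric[OF that] by (simp add: conformal_metric_def transpose_def vec_eq_iff)
  show "v \<bullet> (conformal_metric c g x p *v v) > 0" if "p \<in> chart_dom x" "v \<noteq> 0" for p v
    using positive[OF that] c_pos[OF that(1)]
    by (simp add: conformal_metric_def scaleR_matrix_vector_assoc[symmetric])
qed (rule chart)

interpretation C: riemannian_chart x "conformal_metric c g"
  by (rule conformal_chart)

lemma conformal_gradient:
  assumes p: "p \<in> chart_dom x"
  shows "C.gradient \<phi> p = (1 / c p) *\<^sub>R gradient \<phi> p"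
proof -
  have "conformal_metric c g x p *v ((1 / c p) *\<^sub>R gradient \<phi> p) = differential \<phi> x p"
    using c_pos[OF p]
    by (simp add: conformal_metric_def scaleR_matrix_vector_assoc[symmetric] matrix_vector_mult_scaleR
        lower_gradient[OF p])
  then show ?thesis
    using C.metric_inv(2)[OF p, of "(1 / c p) *\<^sub>R gradient \<phi> p"] by (simp add: C.gradient_def)
qed

lemma conformal_metric_derivative:
  assumes p: "p \<in> chart_dom x"
  shows "chart_derivative x (conformal_metric c g x) p h =
    c p *\<^sub>R chart_derivative x (g x) p h + chart_derivative x c p h *\<^sub>R g x p"
  using has_derivative_scaleR[OF has_chart_derivative[OF chart c p] has_chart_derivative[OF chart smooth_metric p]]
  unfolding conformal_metric_def by (subst chart_derivativeI) (auto simp: param_coord[OF chart p])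

text \<open>The metric gains the factor \<open>c\<close> and the gradient loses it, so every term
  without a derivative of \<open>c\<close> is unchanged. The two corrections come from the product
  rule for \<open>c g\<close>.\<close>

lemma conformal_hessian_form:
  assumes p: "p \<in> chart_dom x"
  shows "C.hessian_form \<phi> p v = hessian_form \<phi> p v
    - chart_derivative x c p v / c p * (v \<bullet> (g x p *v gradient \<phi> p))
    + chart_derivative x c p (gradient \<phi> p) / (2 * c p) * (v \<bullet> (g x p *v v))"
proof -
  interpret G: bounded_linear "chart_derivative x (g x) p"
    by (rule bounded_linear_chart_derivative[OF chart smooth_metric p])
  interpret c: bounded_linear "chart_derivative x c p"
    by (rule bounded_linear_chart_derivative[OF chart c p])
  show ?thesis
    using c_pos[OF p]
    by (simp add: C.hessian_form_def hessian_form_def conformal_gradient[OF p]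
        conformal_metric_derivative[OF p] G.scaleR c.scaleR matrix_vector_mult_add_rdistrib
        scaleR_matrix_vector_assoc[symmetric] matrix_vector_mult_scaleR inner_add_right field_simps)
qed

end

text \<open>For \<open>v\<close> orthogonal to \<open>X\<close> only the last correction of
  \<open>conformal_hessian_form\<close> survives and gives \<open>k\<close>. At \<open>X\<close>
  both corrections are present and add up to \<open>-k\<close>, because \<open>v\<close> and
  \<open>X\<close> have equal length.\<close>

lemma conformal_carleman_condition:
  assumes c: "smooth_in_chart x c" "\<And>p. p \<in> chart_dom x \<Longrightarrow> c p > 0"
    and \<phi>: "smooth_in_chart x \<phi>" and p: "p \<in> chart_dom x"
  shows "riemannian_chart.carleman_condition x (conformal_metric c g) \<phi> p \<longleftrightarrow> carleman_condition \<phi> p"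
proof -
  interpret C: riemannian_chart x "conformal_metric c g"
    by (rule conformal_chart[OF c])
  define X where "X = gradient \<phi> p"
  let ?P = "\<lambda>v. v \<bullet> (g x p *v X) = 0 \<and> v \<bullet> (g x p *v v) = X \<bullet> (g x p *v X) \<longrightarrow>
        hessian_form \<phi> p v + hessian_form \<phi> p X = 0"
  let ?Q = "\<lambda>v. v \<bullet> (conformal_metric c g x p *v C.gradient \<phi> p) = 0 \<and>
       v \<bullet> (conformal_metric c g x p *v v) = C.gradient \<phi> p \<bullet> (conformal_metric c g x p *v C.gradient \<phi> p) \<longrightarrow>
        C.hessian_form \<phi> p v + C.hessian_form \<phi> p (C.gradient \<phi> p) = 0"
  have cp: "c p > 0" by (rule c(2)[OF p])
  have grad: "C.gradient \<phi> p = (1 / c p) *\<^sub>R X"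
    unfolding X_def by (rule conformal_gradient[OF c p])
  \<comment> \<open>Dividing by \<open>c\<close> keeps the covector fixed: lowering
    \<open>v / c\<close> by \<open>c g\<close> equals lowering \<open>v\<close> by \<open>g\<close>.
    So this substitution matches the two zero sets.\<close>
  have "?Q ((1 / c p) *\<^sub>R v) \<longleftrightarrow> ?P v" for v
  proof -
    have 1: "((1 / c p) *\<^sub>R v) \<bullet> (conformal_metric c g x p *v (1 / c p) *\<^sub>R w) = (1 / c p) * (v \<bullet> (g x p *v w))" for v w
      using cp by (simp add: conformal_metric_def scaleR_matrix_vector_assoc[symmetric] matrix_vector_mult_scaleR)
    have 2: "C.hessian_form \<phi> p ((1 / c p) *\<^sub>R v) + C.hessian_form \<phi> p ((1 / c p) *\<^sub>R X) =
       (1 / c p)\<^sup>2 * (hessian_form \<phi> p v + hessian_form \<phi> p X)"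
      if "v \<bullet> (g x p *v X) = 0" "v \<bullet> (g x p *v v) = X \<bullet> (g x p *v X)"
    proof -
      define k where "k = chart_derivative x c p X / (2 * c p) * (X \<bullet> (g x p *v X))"
      have "C.hessian_form \<phi> p v = hessian_form \<phi> p v + k"
        using conformal_hessian_form[OF c p, of \<phi> v] that by (simp add: X_def[symmetric] k_def)
      moreover have "C.hessian_form \<phi> p X = hessian_form \<phi> p X - k"
        using conformal_hessian_form[OF c p, of \<phi> X] by (simp add: X_def[symmetric] k_def)
      ultimately have "C.hessian_form \<phi> p v + C.hessian_form \<phi> p X = hessian_form \<phi> p v + hessian_form \<phi> p X"
        by simp
      then show ?thesis
        unfolding C.hessian_form_scaleR[OF \<phi> p] by (simp add: distrib_left[symmetric])
    qed
    show ?thesis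
      unfolding grad 1 using 2 cp by auto
  qed
  moreover have "(\<forall>v. ?Q v) \<longleftrightarrow> (\<forall>v. ?Q ((1 / c p) *\<^sub>R v))"
  proof
    assume *: "\<forall>v. ?Q ((1 / c p) *\<^sub>R v)"
    show "\<forall>v. ?Q v"
    proof
      fix v
      show "?Q v" using *[rule_format, of "c p *\<^sub>R v"] cp by simp
    qed
  qed blast
  ultimately show ?thesis
    unfolding C.carleman_condition_def carleman_condition_def X_def by blast
qed

end

section \<open>From single charts to the whole atlas\<close>

lemma riemannian_metric_chart:
  assumes "oriented_manifold A" "riemannian_metric A g" "x \<in> A"
  shows "riemannian_chart x g"
  using assms unfolding oriented_manifold_def riemannian_metric_def by unfold_locales blast+

lemma limiting_carleman_weight_iff:
  assumes "oriented_manifold A" "riemannian_metric A g"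
  shows "limiting_carleman_weight A g \<phi> \<longleftrightarrow> smooth_function A \<phi> \<and>
     (\<forall>x\<in>A. \<forall>p\<in>chart_dom x. differential \<phi> x p \<noteq> 0) \<and>
     (\<forall>x\<in>A. \<forall>p\<in>chart_dom x. riemannian_chart.carleman_condition x g \<phi> p)"
  unfolding limiting_carleman_weight_def
  using riemannian_chart.carleman_condition_iff[OF riemannian_metric_chart[OF assms]]
  by (auto simp: smooth_function_def)

lemma riemannian_metric_conformal:
  assumes M: "oriented_manifold A" and g: "riemannian_metric A g"
    and c: "smooth_function A c" "\<forall>p\<in>points A. 0 < c p"
  shows "riemannian_metric A (conformal_metric c g)"
proof -
  have "riemannian_chart x (conformal_metric c g)" if "x \<in> A" for x
    using riemannian_chart.conformal_chart[OF riemannian_metric_chart[OF M g that], of c] c that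
    unfolding smooth_function_def points_def by blast
  moreover have "conformal_metric c g x p =
      transpose (transition_jacobian x y p) ** conformal_metric c g y p ** transition_jacobian x y p"
    if "x \<in> A" "y \<in> A" "p \<in> chart_dom x \<inter> chart_dom y" for x y p
  proof -
    have "g x p = transpose (transition_jacobian x y p) ** g y p ** transition_jacobian x y p"
      using g that unfolding riemannian_metric_def by blast
    then show ?thesis
      by (simp add: conformal_metric_def matrix_scalar_ac scalar_matrix_assoc)
  qed
  ultimately show ?thesis
    unfolding riemannian_metric_def riemannian_chart_def by blast
qed

lemma limiting_carleman_weight_conformal:
  assumes M: "oriented_manifold A" and g: "riemannian_metric A g"
    and c: "smooth_function A c" "\<forall>p\<in>points A. 0 < c p"
  shows "limiting_carleman_weight A (conformal_metric c g) \<phi> \<longleftrightarrow> limiting_carleman_weight A g \<phi>"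
proof -
  have "riemannian_chart.carleman_condition x (conformal_metric c g) \<phi> p \<longleftrightarrow>
      riemannian_chart.carleman_condition x g \<phi> p"
    if "smooth_function A \<phi>" "x \<in> A" "p \<in> chart_dom x" for x p
    using that c
    by (intro riemannian_chart.conformal_carleman_condition[OF riemannian_metric_chart[OF M g]])
      (auto simp: smooth_function_def points_def)
  then show ?thesis
    unfolding limiting_carleman_weight_iff[OF M g]
      limiting_carleman_weight_iff[OF M riemannian_metric_conformal[OF M g c]] by blast
qed

section \<open>Change of charts and the field obtained from a weight\<close>

context
  fixes A :: "('a::{second_countable_topology,t2_space}, 'n::finite) chart set"
  assumes M: "oriented_manifold A"
begin

lemma manifold_chart: "x \<in> A \<Longrightarrow> is_chart x"
  using M unfolding oriented_manifold_def by blast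

lemma open_overlap_image:
  assumes "x \<in> A" "open U"
  shows "open (coord x ` (chart_dom x \<inter> U))"
proof -
  note ch = manifold_chart[OF assms(1)]
  have "continuous_on (coord x ` chart_dom x) (param x)"
    using ch by (simp add: is_chart_def homeomorphism_def)
  then have "open (coord x ` chart_dom x \<inter> param x -` U)"
    by (rule continuous_open_preimage[OF _ open_chart_image[OF ch] assms(2)])
  moreover have "coord x ` chart_dom x \<inter> param x -` U = coord x ` (chart_dom x \<inter> U)"
    using param_coord[OF ch] by auto
  ultimately show ?thesis by simp
qed

lemma open_chart_dom: "x \<in> A \<Longrightarrow> open (chart_dom x)"
  using manifold_chart by (simp add: is_chart_def)

lemma transition_has_derivative:
  assumes "x \<in> A" "y \<in> A" "p \<in> chart_dom x" "p \<in> chart_dom y"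
  shows "((\<lambda>z. coord y (param x z)) has_derivative (\<lambda>h. transition_jacobian x y p *v h)) (at (coord x p))"
proof -
  let ?S = "coord x ` (chart_dom x \<inter> chart_dom y)"
  have "smooth_on ?S (coord y \<circ> param x)"
    using M assms unfolding oriented_manifold_def by blast
  moreover have "open ?S" by (rule open_overlap_image[OF assms(1) open_chart_dom[OF assms(2)]])
  ultimately have "(coord y \<circ> param x) differentiable (at (coord x p))"
    using assms smooth_on_has_derivative unfolding differentiable_def by blast
  then show ?thesis
    by (simp add: transition_jacobian_def jacobian_works o_def)
qed

text \<open>On the overlap, \<open>f\<close> in the coordinates of \<open>x\<close> is
  \<open>f\<close> in those of \<open>y\<close> composed with the transition map, so the chain rule
  applies.\<close>

lemma has_derivative_change_chart:
  assumes "x \<in> A" "y \<in> A" "p \<in> chart_dom x" "p \<in> chart_dom y"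
    and "((\<lambda>z. f (param y z)) has_derivative D) (at (coord y p))"
  shows "((\<lambda>z. f (param x z)) has_derivative (\<lambda>h. D (transition_jacobian x y p *v h))) (at (coord x p))"
proof (rule has_derivative_transform_within_open)
  show "((\<lambda>z. f (param y (coord y (param x z)))) has_derivative
      (\<lambda>h. D (transition_jacobian x y p *v h))) (at (coord x p))"
    using assms(5)
    by (intro has_derivative_compose[OF transition_has_derivative[OF assms(1-4)], of "\<lambda>z. f (param y z)"])
      (simp add: param_coord[OF manifold_chart[OF assms(1)] assms(3)])
  show "open (coord x ` (chart_dom x \<inter> chart_dom y))"
    by (rule open_overlap_image[OF assms(1) open_chart_dom[OF assms(2)]])
  show "coord x p \<in> coord x ` (chart_dom x \<inter> chart_dom y)" using assms by blast
  show "f (param y (coord y (param x z))) = f (param x z)"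
    if "z \<in> coord x ` (chart_dom x \<inter> chart_dom y)" for z
    using that param_coord[OF manifold_chart[OF assms(1)]] param_coord[OF manifold_chart[OF assms(2)]]
    by auto
qed

lemma differential_change_chart:
  assumes "x \<in> A" "y \<in> A" "p \<in> chart_dom x" "p \<in> chart_dom y" "smooth_function A \<phi>"
  shows "differential \<phi> x p \<bullet> h = differential \<phi> y p \<bullet> (transition_jacobian x y p *v h)"
proof -
  have sm: "smooth_in_chart x \<phi>" "smooth_in_chart y \<phi>"
    using assms by (auto simp: smooth_function_def)
  have "chart_derivative x \<phi> p = (\<lambda>h. chart_derivative y \<phi> p (transition_jacobian x y p *v h))"
    by (intro chart_derivativeI has_derivative_change_chart assms has_chart_derivative manifold_chart sm)
  then show ?thesis
    by (simp add: differential_eq_chart_derivative manifold_chart assms sm)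
qed

context
  fixes g \<phi>
  assumes g: "riemannian_metric A g" and \<phi>: "smooth_function A \<phi>"
begin

text \<open>Metric and differential both pull back along the Jacobian \<open>J\<close>. Hence the
  push-forward of the gradient by \<open>J\<close> solves the equation that determines the gradient
  in the chart \<open>y\<close>.\<close>

lemma gradient_change_chart:
  assumes "x \<in> A" "y \<in> A" "p \<in> chart_dom x" "p \<in> chart_dom y"
  shows "riemannian_chart.gradient y g \<phi> p = transition_jacobian x y p *v riemannian_chart.gradient x g \<phi> p"
proof -
  interpret X: riemannian_chart x g by (rule riemannian_metric_chart[OF M g assms(1)])
  interpret Y: riemannian_chart y g by (rule riemannian_metric_chart[OF M g assms(2)])
  define J where "J = transition_jacobian x y p"
  have gJ: "g x p = transpose J ** g y p ** J"
    using g assms unfolding riemannian_metric_def J_def by blast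
  have "det J > 0" using M assms unfolding oriented_manifold_def J_def by blast
  then have inv: "invertible J" by (simp add: invertible_det_nz)
  have "h \<bullet> (g y p *v (J *v X.gradient \<phi> p)) = h \<bullet> differential \<phi> y p" for h
  proof -
    \<comment> \<open>As \<open>J\<close> is invertible, it is enough to test against vectors of the
      form \<open>J *v k\<close>.\<close>
    define k where "k = matrix_inv J *v h"
    have h: "h = J *v k" by (simp add: k_def matrix_inv_vector_mult[OF inv])
    have "h \<bullet> (g y p *v (J *v X.gradient \<phi> p)) = k \<bullet> (transpose J *v (g y p *v (J *v X.gradient \<phi> p)))"
      unfolding h by (metis dot_lmul_matrix inner_commute transpose_matrix_vector)
    also have "\<dots> = k \<bullet> (g x p *v X.gradient \<phi> p)"
      by (simp add: gJ matrix_vector_mul_assoc matrix_mul_assoc del: transpose_matrix_vector)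
    also have "\<dots> = h \<bullet> differential \<phi> y p"
      using differential_change_chart[OF assms \<phi>, of k]
      by (simp add: X.lower_gradient[OF assms(3)] h J_def inner_commute)
    finally show ?thesis .
  qed
  then have "g y p *v (J *v X.gradient \<phi> p) = differential \<phi> y p"
    by (metis vector_eq_ldot)
  then show ?thesis
    unfolding J_def[symmetric] by (metis Y.gradient_def Y.metric_inv(2) assms(4))
qed

lemma gradient_vector_field:
  "vector_field A (\<lambda>x. riemannian_chart.gradient x g \<phi>)"
  unfolding vector_field_def
proof (intro conjI ballI)
  fix x assume "x \<in> A"
  then show "smooth_in_chart x (riemannian_chart.gradient x g \<phi>)"
    using \<phi> by (intro riemannian_chart.smooth_gradient[OF riemannian_metric_chart[OF M g]])
      (auto simp: smooth_function_def)
qed (auto intro: gradient_change_chart)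

text \<open>The conformal factor must be one function on points, not a family over charts. A chart
  is chosen at every point, and the transformation laws show that the choice does not
  matter.\<close>

lemma gradient_norm_function:
  obtains c where "smooth_function A c"
    "\<And>x p. x \<in> A \<Longrightarrow> p \<in> chart_dom x \<Longrightarrow> c p = differential \<phi> x p \<bullet> riemannian_chart.gradient x g \<phi> p"
proof
  define N where "N x p = differential \<phi> x p \<bullet> riemannian_chart.gradient x g \<phi> p" for x p
  define c where "c p = N (SOME x. x \<in> A \<and> p \<in> chart_dom x) p" for p
  show eq: "c p = differential \<phi> x p \<bullet> riemannian_chart.gradient x g \<phi> p"
    if "x \<in> A" "p \<in> chart_dom x" for x p
  proof -
    define y where "y = (SOME x. x \<in> A \<and> p \<in> chart_dom x)"
    have y: "y \<in> A \<and> p \<in> chart_dom y"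
      unfolding y_def by (rule someI[of _ x]) (use that in simp)
    then show ?thesis
      using that gradient_change_chart[of x y p] differential_change_chart[OF _ _ _ _ \<phi>, of x y p]
      by (simp add: c_def y_def[symmetric] N_def)
  qed
  show "smooth_function A c"
    unfolding smooth_function_def
  proof
    fix x assume x: "x \<in> A"
    interpret X: riemannian_chart x g by (rule riemannian_metric_chart[OF M g x])
    have "smooth_in_chart x (\<lambda>p. differential \<phi> x p \<bullet> X.gradient \<phi> p)"
      using \<phi> x smooth_differential[OF X.chart] X.smooth_gradient
      unfolding smooth_in_chart_iff smooth_function_def
      by (intro smooth_on_bounded_bilinear[OF _ bounded_bilinear_inner] open_chart_image[OF X.chart]) auto
    then show "smooth_in_chart x c"
      using smooth_in_chart_cong[OF X.chart, of c "\<lambda>p. differential \<phi> x p \<bullet> X.gradient \<phi> p"] eq[OF x] by simp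
  qed
qed

end

lemma limiting_carleman_weight_imp_parallel:
  assumes g: "riemannian_metric A g" and \<phi>: "limiting_carleman_weight A g \<phi>"
  shows "\<exists>c. smooth_function A c \<and> (\<forall>p\<in>points A. 0 < c p) \<and>
    (\<exists>X. parallel_field A (conformal_metric c g) X \<and> unit_field A (conformal_metric c g) X)"
proof -
  have sm: "smooth_function A \<phi>" and nz: "\<forall>x\<in>A. \<forall>p\<in>chart_dom x. differential \<phi> x p \<noteq> 0"
    using \<phi> by (auto simp: limiting_carleman_weight_def)
  obtain c where c: "smooth_function A c"
    "\<And>x p. x \<in> A \<Longrightarrow> p \<in> chart_dom x \<Longrightarrow> c p = differential \<phi> x p \<bullet> riemannian_chart.gradient x g \<phi> p"
    using gradient_norm_function[OF g sm] by blast
  have c_pos: "\<forall>p\<in>points A. 0 < c p"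
  proof
    fix p assume "p \<in> points A"
    then obtain x where x: "x \<in> A" "p \<in> chart_dom x" by (auto simp: points_def)
    interpret X: riemannian_chart x g by (rule riemannian_metric_chart[OF M g x(1)])
    have "X.gradient \<phi> p \<noteq> 0" using nz x X.lower_gradient[OF x(2), of \<phi>] by auto
    then show "0 < c p"
      using X.positive[OF x(2), of "X.gradient \<phi> p"]
      by (simp add: c(2)[OF x] X.lower_gradient[OF x(2)] inner_commute)
  qed
  define g' where "g' = conformal_metric c g"
  have g': "riemannian_metric A g'"
    unfolding g'_def by (rule riemannian_metric_conformal[OF M g c(1) c_pos])
  have \<phi>': "limiting_carleman_weight A g' \<phi>"
    unfolding g'_def using \<phi> limiting_carleman_weight_conformal[OF M g c(1) c_pos] by blast
  define X where "X = (\<lambda>x. riemannian_chart.gradient x g' \<phi>)"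
  have vf: "vector_field A X"
    unfolding X_def by (rule gradient_vector_field[OF g' sm])
  \<comment> \<open>The new gradient is the old one divided by \<open>c\<close>, and lowering it
    gives \<open>d\<phi>\<close>. Its squared length is therefore
    \<open>|d\<phi>|\<^sup>2 / c\<close>, which is 1 by the choice of \<open>c\<close>.\<close>
  have unit: "X x p \<bullet> (g' x p *v X x p) = 1" if x: "x \<in> A" "p \<in> chart_dom x" for x p
  proof -
    interpret G: riemannian_chart x g by (rule riemannian_metric_chart[OF M g x(1)])
    interpret G': riemannian_chart x g' by (rule riemannian_metric_chart[OF M g' x(1)])
    have pos: "c p > 0" if "p \<in> chart_dom x" for p using c_pos x that by (auto simp: points_def)
    have "X x p = (1 / c p) *\<^sub>R G.gradient \<phi> p"
      unfolding X_def g'_def using c(1) x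
      by (intro G.conformal_gradient pos) (auto simp: smooth_function_def)
    moreover have "g' x p *v X x p = differential \<phi> x p"
      unfolding X_def by (rule G'.lower_gradient[OF x(2)])
    ultimately show ?thesis
      using pos[OF x(2)] by (simp add: c(2)[OF x] inner_commute)
  qed
  have "covariant_derivative g' X x p i k = 0" if x: "x \<in> A" "p \<in> chart_dom x" for x p i k
  proof -
    interpret G': riemannian_chart x g' by (rule riemannian_metric_chart[OF M g' x(1)])
    have smx: "smooth_in_chart x \<phi>" using sm x by (simp add: smooth_function_def)
    have "G'.carleman_condition \<phi> p"
      using \<phi>' x limiting_carleman_weight_iff[OF M g'] by blast
    then have "G'.covariant_form (X x) p v w = 0" for v w
      unfolding X_def using unit[OF x(1)]
      by (intro G'.unit_gradient_covariant_form smx x) (simp_all add: X_def)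
    moreover have "smooth_in_chart x (X x)"
      unfolding X_def by (rule G'.smooth_gradient[OF smx])
    ultimately show ?thesis
      using G'.covariant_derivative_zero_iff[where X = X, OF _ x(2)] by blast
  qed
  then have "parallel_field A g' X" "unit_field A g' X"
    using vf unit by (auto simp: parallel_field_def unit_field_def)
  then show ?thesis
    unfolding g'_def using c(1) c_pos by blast
qed

end

subsection \<open>Primitives along paths\<close>

text \<open>An element \<open>(U, f)\<close> of \<open>P\<close> stands for a primitive \<open>f\<close> on \<open>U\<close> of one fixed closed form.\<close>

locale local_primitives =
  fixes S :: "'a::topological_space set" and P :: "('a set \<times> ('a \<Rightarrow> real)) set"
  assumes cover: "p \<in> S \<Longrightarrow> \<exists>U f. (U, f) \<in> P \<and> p \<in> U"
    and domain: "(U, f) \<in> P \<Longrightarrow> open U \<and> path_connected U \<and> U \<subseteq> S"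
    and overlap: "(U, f) \<in> P \<Longrightarrow> (V, f') \<in> P \<Longrightarrow> p \<in> U \<Longrightarrow> p \<in> V \<Longrightarrow>
      \<exists>W. open W \<and> p \<in> W \<and> (\<forall>q\<in>W. f q - f p = f' q - f' p)"
begin

text \<open>A primitive along a merely continuous path: near each time it changes exactly as the
  local primitives do. Membership in \<open>{a..b}\<close> inside \<open>nhds\<close> makes the
  condition one-sided at the end points.\<close>

definition continuation :: "(real \<Rightarrow> 'a) \<Rightarrow> real \<Rightarrow> real \<Rightarrow> (real \<Rightarrow> real) \<Rightarrow> bool" where
  "continuation \<gamma> a b F \<longleftrightarrow> (\<forall>t\<in>{a..b}. \<forall>U f. (U, f) \<in> P \<longrightarrow> \<gamma> t \<in> U \<longrightarrow>
     (\<forall>\<^sub>F s in nhds t. s \<in> {a..b} \<longrightarrow> F s - F t = f (\<gamma> s) - f (\<gamma> t)))"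

lemma eventually_path_in:
  fixes a b :: real
  assumes "continuous_on {a..b} \<gamma>" "t \<in> {a..b}" "open W" "\<gamma> t \<in> W"
  shows "\<forall>\<^sub>F s in nhds t. s \<in> {a..b} \<longrightarrow> \<gamma> s \<in> W"
proof -
  have "\<forall>\<^sub>F s in at t within {a..b}. \<gamma> s \<in> W"
    using assms(1)[unfolded continuous_on_def, rule_format, OF assms(2)] assms(3,4)
    by (rule topological_tendstoD)
  then show ?thesis
    unfolding eventually_at_filter by (rule eventually_mono) (use assms(4) in auto)
qed

lemma continuation_in_domain:
  assumes \<gamma>: "continuous_on {a..b} \<gamma>" "\<gamma> ` {a..b} \<subseteq> U" and U: "(U, f) \<in> P"
  shows "continuation \<gamma> a b (\<lambda>t. f (\<gamma> t))"
  unfolding continuation_def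
proof (intro ballI allI impI)
  fix t V f' assume t: "t \<in> {a..b}" and V: "(V, f') \<in> P" "\<gamma> t \<in> V"
  have "\<gamma> t \<in> U" using \<gamma> t by blast
  then obtain W where W: "open W" "\<gamma> t \<in> W" "\<forall>q\<in>W. f q - f (\<gamma> t) = f' q - f' (\<gamma> t)"
    using overlap[OF U V(1) _ V(2)] by blast
  show "\<forall>\<^sub>F s in nhds t. s \<in> {a..b} \<longrightarrow> f (\<gamma> s) - f (\<gamma> t) = f' (\<gamma> s) - f' (\<gamma> t)"
    using eventually_path_in[OF \<gamma>(1) t W(1,2)] by (rule eventually_mono) (use W in blast)
qed

lemma continuation_subinterval:
  "continuation \<gamma> a b F \<Longrightarrow> a \<le> c \<Longrightarrow> d \<le> b \<Longrightarrow> continuation \<gamma> c d F"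
  unfolding continuation_def by (fastforce elim!: eventually_mono)

lemma continuation_cong:
  "continuation \<gamma> a b F \<Longrightarrow> (\<And>t. t \<in> {a..b} \<Longrightarrow> \<gamma> t = \<gamma>' t) \<Longrightarrow> continuation \<gamma>' a b F"
  unfolding continuation_def by (fastforce elim!: eventually_mono)

text \<open>\<open>G\<close> is shifted by a constant to agree with \<open>F\<close> at
  \<open>b\<close>. Only \<open>t = b\<close> needs both pieces, each covering one side.\<close>

lemma continuation_append:
  assumes F: "continuation \<gamma> a b F" and G: "continuation \<gamma> b c G" and "a \<le> b" "b \<le> c"
  shows "continuation \<gamma> a c (\<lambda>t. if t \<le> b then F t else G t - G b + F b)" (is "continuation _ _ _ ?H")
  unfolding continuation_def
proof (intro ballI allI impI)
  fix t U f assume t: "t \<in> {a..c}" and U: "(U, f) \<in> P" "\<gamma> t \<in> U"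
  consider "t < b" | "t = b" | "t > b" by linarith
  then show "\<forall>\<^sub>F s in nhds t. s \<in> {a..c} \<longrightarrow> ?H s - ?H t = f (\<gamma> s) - f (\<gamma> t)"
  proof cases
    case 1
    have "\<forall>\<^sub>F s in nhds t. s \<in> {a..b} \<longrightarrow> F s - F t = f (\<gamma> s) - f (\<gamma> t)"
      using F t U 1 unfolding continuation_def by auto
    moreover have "\<forall>\<^sub>F s in nhds t. s < b" using 1 by (rule eventually_nhds_in_open[OF open_lessThan, simplified])
    ultimately show ?thesis by eventually_elim (use 1 in auto)
  next
    case 2
    have "\<forall>\<^sub>F s in nhds t. s \<in> {a..b} \<longrightarrow> F s - F t = f (\<gamma> s) - f (\<gamma> t)"
      using F t U 2 unfolding continuation_def by auto
    moreover have "\<forall>\<^sub>F s in nhds t. s \<in> {b..c} \<longrightarrow> G s - G t = f (\<gamma> s) - f (\<gamma> t)"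
      using G t U 2 unfolding continuation_def by auto
    ultimately show ?thesis by eventually_elim (use 2 in auto)
  next
    case 3
    have "\<forall>\<^sub>F s in nhds t. s \<in> {b..c} \<longrightarrow> G s - G t = f (\<gamma> s) - f (\<gamma> t)"
      using G t U 3 unfolding continuation_def by auto
    moreover have "\<forall>\<^sub>F s in nhds t. s > b" using 3 by (rule eventually_nhds_in_open[OF open_greaterThan, simplified])
    ultimately show ?thesis by eventually_elim (use 3 in auto)
  qed
qed

lemma path_local:
  fixes a b :: real
  assumes \<gamma>: "continuous_on {a..b} \<gamma>" and t: "t \<in> {a..b}" and W: "open W" "\<gamma> t \<in> W"
  obtains d where "d > 0" "\<And>u v. u \<le> t \<Longrightarrow> t \<le> v \<Longrightarrow> v - u < d \<Longrightarrow> a \<le> u \<Longrightarrow> v \<le> b \<Longrightarrow> \<gamma> ` {u..v} \<subseteq> W"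
proof -
  obtain d where d: "d > 0" "\<And>s. dist s t < d \<Longrightarrow> s \<in> {a..b} \<longrightarrow> \<gamma> s \<in> W"
    using eventually_path_in[OF assms] unfolding eventually_nhds_metric by blast
  show thesis
  proof (rule that[OF d(1)])
    show "\<gamma> ` {u..v} \<subseteq> W" if "u \<le> t" "t \<le> v" "v - u < d" "a \<le> u" "v \<le> b" for u v
      using that d(2) by (auto simp: dist_real_def)
  qed
qed

text \<open>Short pieces of the path lie in a single domain, and pieces can be appended, so
  \<open>Bolzano\<close> applies. The guard in its predicate is needed because the intervals
  considered there may leave \<open>{a..b}\<close>.\<close>

lemma continuation_exists:
  assumes \<gamma>: "continuous_on {a..b} \<gamma>" "\<gamma> ` {a..b} \<subseteq> S" and "a \<le> b"
  shows "\<exists>F. continuation \<gamma> a b F"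
proof -
  have "a \<le> a \<and> b \<le> b \<longrightarrow> (\<exists>F. continuation \<gamma> a b F)"
    using \<open>a \<le> b\<close>
  proof (induction rule: Bolzano[where P = "\<lambda>u v. a \<le> u \<and> v \<le> b \<longrightarrow> (\<exists>F. continuation \<gamma> u v F)"])
    case (trans u v w)
    show ?case
    proof
      assume "a \<le> u \<and> w \<le> b"
      then obtain F G where "continuation \<gamma> u v F" "continuation \<gamma> v w G" using trans by auto
      then show "\<exists>F. continuation \<gamma> u w F" using continuation_append trans by blast
    qed
  next
    case (local t)
    then have "\<gamma> t \<in> S" using \<gamma>(2) by auto
    then obtain U f where U: "(U, f) \<in> P" "\<gamma> t \<in> U" using cover by blast
    obtain d where d: "d > 0" "\<And>u v. u \<le> t \<Longrightarrow> t \<le> v \<Longrightarrow> v - u < d \<Longrightarrow> a \<le> u \<Longrightarrow> v \<le> b \<Longrightarrow> \<gamma> ` {u..v} \<subseteq> U"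
      using path_local[OF \<gamma>(1), of t U] domain[OF U(1)] U(2) local by auto
    have "\<exists>F. continuation \<gamma> u v F" if "u \<le> t" "t \<le> v" "v - u < d" "a \<le> u" "v \<le> b" for u v
      using continuation_in_domain[OF continuous_on_subset[OF \<gamma>(1)] d(2)[OF that] U(1)] that by auto
    then show ?case using d(1) by blast
  qed
  then show ?thesis by simp
qed

text \<open>Near each time both functions change like the same local primitive. Equality of changes
  is additive over adjacent intervals, so \<open>Bolzano\<close> extends it to
  \<open>{a..b}\<close>.\<close>

lemma continuation_unique:
  assumes F: "continuation \<gamma> a b F" and G: "continuation \<gamma> a b G" and "\<gamma> ` {a..b} \<subseteq> S" "a \<le> b"
  shows "F b - F a = G b - G a"
proof -
  have "a \<le> a \<and> b \<le> b \<longrightarrow> F b - F a = G b - G a"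
    using \<open>a \<le> b\<close>
  proof (induction rule: Bolzano[where P = "\<lambda>u v. a \<le> u \<and> v \<le> b \<longrightarrow> F v - F u = G v - G u"])
    case (local t)
    then have "\<gamma> t \<in> S" using assms(3) by auto
    then obtain U f where U: "(U, f) \<in> P" "\<gamma> t \<in> U" using cover by blast
    have "\<forall>\<^sub>F s in nhds t. s \<in> {a..b} \<longrightarrow> F s - F t = f (\<gamma> s) - f (\<gamma> t)"
      "\<forall>\<^sub>F s in nhds t. s \<in> {a..b} \<longrightarrow> G s - G t = f (\<gamma> s) - f (\<gamma> t)"
      using F G U local unfolding continuation_def by auto
    then have "\<forall>\<^sub>F s in nhds t. s \<in> {a..b} \<longrightarrow> F s - F t = G s - G t"
      by eventually_elim auto
    then obtain d where d: "d > 0" "\<And>s. dist s t < d \<Longrightarrow> s \<in> {a..b} \<longrightarrow> F s - F t = G s - G t"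
      unfolding eventually_nhds_metric by blast
    have "F v - F u = G v - G u" if "u \<le> t" "t \<le> v" "v - u < d" "a \<le> u" "v \<le> b" for u v
      using d(2)[of u] d(2)[of v] that by (simp add: dist_real_def)
    then show ?case using d(1) by blast
  qed linarith
  then show ?thesis by simp
qed

text \<open>The integral of the closed form along \<open>\<gamma>\<close>;
  \<open>continuation_unique\<close> makes it independent of the choice for paths inside
  \<open>S\<close>.\<close>

definition increment :: "(real \<Rightarrow> 'a) \<Rightarrow> real \<Rightarrow> real \<Rightarrow> real" where
  "increment \<gamma> a b = (let F = (SOME F. continuation \<gamma> a b F) in F b - F a)"

lemma increment_eq:
  assumes "continuation \<gamma> a b F" "\<gamma> ` {a..b} \<subseteq> S" "a \<le> b"
  shows "increment \<gamma> a b = F b - F a"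
  unfolding increment_def Let_def
  by (rule continuation_unique[OF someI[of "continuation \<gamma> a b", OF assms(1)] assms])

lemma increment_in_domain:
  assumes "continuous_on {a..b} \<gamma>" "\<gamma> ` {a..b} \<subseteq> U" "(U, f) \<in> P" "a \<le> b"
  shows "increment \<gamma> a b = f (\<gamma> b) - f (\<gamma> a)"
  using increment_eq[OF continuation_in_domain[OF assms(1-3)]] assms domain by blast

lemma increment_append:
  assumes "continuous_on {a..c} \<gamma>" "\<gamma> ` {a..c} \<subseteq> S" "a \<le> b" "b \<le> c"
  shows "increment \<gamma> a c = increment \<gamma> a b + increment \<gamma> b c"
proof -
  obtain F where F: "continuation \<gamma> a c F"
    using continuation_exists assms by (meson order_trans)
  have im: "\<gamma> ` {a..b} \<subseteq> S" "\<gamma> ` {b..c} \<subseteq> S"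
    using assms by force+
  show ?thesis
    using increment_eq[OF F assms(2)] increment_eq[OF continuation_subinterval[OF F, of a b] im(1)]
      increment_eq[OF continuation_subinterval[OF F, of b c] im(2)] assms by simp
qed

text \<open>A continuation along \<open>\<gamma>\<close> composed with \<open>h\<close> is one along
  the reparametrised path. The two orientations serve for the halves of a joined path and for
  reversal. Agreement with \<open>\<gamma>'\<close> is asked on \<open>{c..d}\<close> only, since
  joined paths are defined by cases.\<close>

lemma increment_compose:
  assumes \<gamma>: "continuous_on {a..b} \<gamma>" "\<gamma> ` {a..b} \<subseteq> S" "a \<le> b"
    and h: "continuous_on UNIV h" "h ` {c..d} \<subseteq> {a..b}" "c \<le> d"
    and ends: "h c = a \<and> h d = b \<or> h c = b \<and> h d = a"
    and \<gamma>': "\<And>t. t \<in> {c..d} \<Longrightarrow> \<gamma>' t = \<gamma> (h t)"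
  shows "increment \<gamma>' c d = (if h c = a \<and> h d = b then 1 else -1) * increment \<gamma> a b"
proof -
  obtain F where F: "continuation \<gamma> a b F"
    using continuation_exists[OF \<gamma>] by blast
  have "continuation (\<lambda>t. \<gamma> (h t)) c d (\<lambda>t. F (h t))"
    unfolding continuation_def
  proof (intro ballI allI impI)
    fix t U f assume t: "t \<in> {c..d}" and U: "(U, f) \<in> P" "\<gamma> (h t) \<in> U"
    have "(h \<longlongrightarrow> h t) (nhds t)"
      using h(1) by (simp add: continuous_on_eq_continuous_at isCont_def tendsto_nhds_iff)
    moreover have "\<forall>\<^sub>F s in nhds (h t). s \<in> {a..b} \<longrightarrow> F s - F (h t) = f (\<gamma> s) - f (\<gamma> (h t))"
      using F U t h(2) unfolding continuation_def by blast
    ultimately have "\<forall>\<^sub>F s in nhds t. h s \<in> {a..b} \<longrightarrow> F (h s) - F (h t) = f (\<gamma> (h s)) - f (\<gamma> (h t))"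
      by (rule eventually_compose_filterlim[rotated])
    then show "\<forall>\<^sub>F s in nhds t. s \<in> {c..d} \<longrightarrow> F (h s) - F (h t) = f (\<gamma> (h s)) - f (\<gamma> (h t))"
      by (rule eventually_mono) (use h in blast)
  qed
  then have "continuation \<gamma>' c d (\<lambda>t. F (h t))"
    by (rule continuation_cong) (simp add: \<gamma>')
  moreover have "\<gamma>' ` {c..d} \<subseteq> S" using h \<gamma> \<gamma>' by force
  ultimately have "increment \<gamma>' c d = F (h d) - F (h c)"
    using increment_eq h(3) by blast
  then show ?thesis
    using increment_eq[OF F \<gamma>(2,3)] ends by auto
qed

lemma increment_cong:
  assumes "continuous_on {a..b} \<gamma>" "\<gamma> ` {a..b} \<subseteq> S" "a \<le> b" "\<And>t. t \<in> {a..b} \<Longrightarrow> \<gamma>' t = \<gamma> t"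
  shows "increment \<gamma>' a b = increment \<gamma> a b"
  using increment_compose[OF assms(1-3), of "\<lambda>t. t" a b \<gamma>'] assms by auto

lemma increment_join:
  assumes \<gamma>: "path \<gamma>" "path_image \<gamma> \<subseteq> S" and \<delta>: "path \<delta>" "path_image \<delta> \<subseteq> S" and "pathfinish \<gamma> = pathstart \<delta>"
  shows "increment (\<gamma> +++ \<delta>) 0 1 = increment \<gamma> 0 1 + increment \<delta> 0 1"
proof -
  have "path (\<gamma> +++ \<delta>)" "path_image (\<gamma> +++ \<delta>) \<subseteq> S"
    using assms by (auto simp: path_image_join)
  then have "increment (\<gamma> +++ \<delta>) 0 1 = increment (\<gamma> +++ \<delta>) 0 (1/2) + increment (\<gamma> +++ \<delta>) (1/2) 1"
    by (intro increment_append) (auto simp: path_def path_image_def)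
  moreover have "increment (\<gamma> +++ \<delta>) 0 (1/2) = increment \<gamma> 0 1"
    using \<gamma> by (subst increment_compose[where h = "\<lambda>t. 2 * t" and a = 0 and b = 1 and \<gamma> = \<gamma>])
      (auto simp: path_def path_image_def joinpaths_def intro!: continuous_intros)
  moreover have "increment (\<gamma> +++ \<delta>) (1/2) 1 = increment \<delta> 0 1"
  proof (subst increment_compose[where h = "\<lambda>t. 2 * t - 1" and a = 0 and b = 1 and \<gamma> = \<delta>])
    show "(\<gamma> +++ \<delta>) t = \<delta> (2 * t - 1)" if "t \<in> {1/2..1}" for t
    \<comment> \<open>At the midpoint \<open>joinpaths\<close> still uses the first path, so
      matching end points are needed here.\<close>
    proof (cases "t = 1/2")
      case True
      then show ?thesis using assms(5) unfolding True by (simp add: joinpaths_def pathfinish_def pathstart_def)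
    qed (use that in \<open>simp add: joinpaths_def\<close>)
  qed (use \<delta> in \<open>auto simp: path_def path_image_def intro!: continuous_intros\<close>)
  ultimately show ?thesis by simp
qed

lemma increment_reversepath:
  assumes \<gamma>: "path \<gamma>" "path_image \<gamma> \<subseteq> S"
  shows "increment (reversepath \<gamma>) 0 1 = - increment \<gamma> 0 1"
  using \<gamma> by (subst increment_compose[where h = "\<lambda>t. 1 - t" and a = 0 and b = 1 and \<gamma> = \<gamma>])
    (auto simp: path_def path_image_def reversepath_def intro!: continuous_intros)

text \<open>Inside one domain both routes give the difference of a primitive between opposite
  corners. Rectangles glue along a common side, where the increments cancel, so
  \<open>Bolzano\<close> in each coordinate reaches the whole square.\<close>

lemma increment_rectangle:
  fixes h :: "real \<times> real \<Rightarrow> 'a"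
  assumes h: "continuous_on ({0..1} \<times> {0..1}) h" "h ` ({0..1} \<times> {0..1}) \<subseteq> S"
  shows "increment (\<lambda>t. h (0, t)) 0 1 + increment (\<lambda>s. h (s, 1)) 0 1 =
    increment (\<lambda>s. h (s, 0)) 0 1 + increment (\<lambda>t. h (1, t)) 0 1"
proof -
  have cont1: "continuous_on {a..b} (\<lambda>s. h (s, t))" and im1: "(\<lambda>s. h (s, t)) ` {a..b} \<subseteq> S"
    if "0 \<le> a" "b \<le> 1" "0 \<le> t" "t \<le> 1" for a b t
    using that h(2) by (auto intro!: continuous_on_compose2[OF h(1)] continuous_intros)
  have cont2: "continuous_on {a..b} (\<lambda>t. h (s, t))" and im2: "(\<lambda>t. h (s, t)) ` {a..b} \<subseteq> S"
    if "0 \<le> a" "b \<le> 1" "0 \<le> s" "s \<le> 1" for a b s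
    using that h(2) by (auto intro!: continuous_on_compose2[OF h(1)] continuous_intros)
  define R where "R a b c d \<longleftrightarrow> increment (\<lambda>t. h (a, t)) c d + increment (\<lambda>s. h (s, d)) a b =
    increment (\<lambda>s. h (s, c)) a b + increment (\<lambda>t. h (b, t)) c d" for a b c d
  have R1: "R a c u v" if "R a b u v" "R b c u v" "0 \<le> a" "a \<le> b" "b \<le> c" "c \<le> 1" "0 \<le> u" "u \<le> v" "v \<le> 1" for a b c u v
    using that increment_append[OF cont1 im1, of a c v b] increment_append[OF cont1 im1, of a c u b]
    unfolding R_def by auto
  have R2: "R u v a c" if "R u v a b" "R u v b c" "0 \<le> a" "a \<le> b" "b \<le> c" "c \<le> 1" "0 \<le> u" "u \<le> v" "v \<le> 1" for a b c u v
    using that increment_append[OF cont2 im2, of a c v b] increment_append[OF cont2 im2, of a c u b]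
    unfolding R_def by auto
  have local: "\<exists>d>0. \<forall>a b u v. 0 \<le> a \<and> a \<le> s \<and> s \<le> b \<and> b \<le> 1 \<and> b - a < d \<and>
      0 \<le> u \<and> u \<le> t \<and> t \<le> v \<and> v \<le> 1 \<and> v - u < d \<longrightarrow> R a b u v" if "s \<in> {0..1}" "t \<in> {0..1}" for s t
  proof -
    have "h (s, t) \<in> S" using h that by blast
    then obtain U f where U: "(U, f) \<in> P" "h (s, t) \<in> U" using cover by blast
    have "\<forall>\<^sub>F z in at (s, t) within {0..1} \<times> {0..1}. h z \<in> U"
      by (rule topological_tendstoD[OF h(1)[unfolded continuous_on_def, rule_format]])
        (use that domain[OF U(1)] U(2) in auto)
    then obtain d where d: "d > 0" "\<And>z. z \<in> {0..1} \<times> {0..1} \<Longrightarrow> dist z (s, t) < d \<Longrightarrow> h z \<in> U"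
      using U(2) unfolding eventually_at by (metis dist_pos_lt)
    \<comment> \<open>Half the radius per coordinate, because the distance in the product is at most
      the sum of the coordinate distances.\<close>
    have "R a b u v" if *: "0 \<le> a" "a \<le> s" "s \<le> b" "b \<le> 1" "b - a < d/2" "0 \<le> u" "u \<le> t" "t \<le> v" "v \<le> 1" "v - u < d/2" for a b u v
    proof -
      have "h (x, y) \<in> U" if "x \<in> {a..b}" "y \<in> {u..v}" for x y
      proof (rule d(2))
        have "dist (x, y) (s, t) \<le> dist x s + dist y t"
          unfolding dist_Pair_Pair by (rule sqrt_sum_squares_le_sum) auto
        also have "\<dots> < d" using that * by (simp add: dist_real_def abs_if)
        finally show "dist (x, y) (s, t) < d" .
      qed (use that * in auto)
      then have 1: "increment (\<lambda>s. h (s, y)) a b = f (h (b, y)) - f (h (a, y))" if "y \<in> {u..v}" for y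
        using that * by (intro increment_in_domain[OF cont1 _ U(1)]) auto
      have 2: "increment (\<lambda>t. h (x, t)) u v = f (h (x, v)) - f (h (x, u))" if "x \<in> {a..b}" for x
        using that * \<open>\<And>x y. x \<in> {a..b} \<Longrightarrow> y \<in> {u..v} \<Longrightarrow> h (x, y) \<in> U\<close>
        by (intro increment_in_domain[OF cont2 _ U(1)]) auto
      show ?thesis
        unfolding R_def using * by (simp add: 1 2)
    qed
    then show ?thesis using d(1) by (intro exI[of _ "d/2"]) auto
  qed
  have "0 \<le> (0::real) \<and> 1 \<le> (1::real) \<longrightarrow> R 0 1 0 1"
    using zero_le_one
  proof (induction rule: Bolzano[where P = "\<lambda>a b. 0 \<le> a \<and> b \<le> 1 \<longrightarrow> R a b 0 1"])
    case (trans a b c)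
    then show ?case using R1[of a b 0 1 c] by auto
  next
    case (local s)
    \<comment> \<open>For fixed \<open>s\<close>, full-height strips around \<open>s\<close> are
      built from short boxes. The admissible width depends on the box, so it is quantified inside
      the predicate, and gluing takes the minimum.\<close>
    have "0 \<le> (0::real) \<and> 1 \<le> (1::real) \<longrightarrow>
      (\<exists>d>0. \<forall>a b. 0 \<le> a \<and> a \<le> s \<and> s \<le> b \<and> b \<le> 1 \<and> b - a < d \<longrightarrow> R a b 0 1)"
      using zero_le_one
    proof (induction rule: Bolzano[where P = "\<lambda>u v. 0 \<le> u \<and> v \<le> 1 \<longrightarrow>
          (\<exists>d>0. \<forall>a b. 0 \<le> a \<and> a \<le> s \<and> s \<le> b \<and> b \<le> 1 \<and> b - a < d \<longrightarrow> R a b u v)"])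
      case (trans u v w)
      show ?case
      proof
        assume *: "0 \<le> u \<and> w \<le> 1"
        obtain d1 where d1: "d1 > 0" "\<And>a b. 0 \<le> a \<and> a \<le> s \<and> s \<le> b \<and> b \<le> 1 \<and> b - a < d1 \<Longrightarrow> R a b u v"
          using trans * by auto
        obtain d2 where d2: "d2 > 0" "\<And>a b. 0 \<le> a \<and> a \<le> s \<and> s \<le> b \<and> b \<le> 1 \<and> b - a < d2 \<Longrightarrow> R a b v w"
          using trans * by auto
        have "R a b u w" if "0 \<le> a" "a \<le> s" "s \<le> b" "b \<le> 1" "b - a < min d1 d2" for a b
          using that d1(2)[of a b] d2(2)[of a b] * trans by (intro R2[of a b u v w]) auto
        then show "\<exists>d>0. \<forall>a b. 0 \<le> a \<and> a \<le> s \<and> s \<le> b \<and> b \<le> 1 \<and> b - a < d \<longrightarrow> R a b u w"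
          using d1(1) d2(1) by (intro exI[of _ "min d1 d2"]) auto
      qed
    next
      case (local t)
      obtain d where "d > 0" "\<And>a b u v. 0 \<le> a \<and> a \<le> s \<and> s \<le> b \<and> b \<le> 1 \<and> b - a < d \<and>
          0 \<le> u \<and> u \<le> t \<and> t \<le> v \<and> v \<le> 1 \<and> v - u < d \<Longrightarrow> R a b u v"
        using \<open>\<And>s t. s \<in> {0..1} \<Longrightarrow> t \<in> {0..1} \<Longrightarrow> _\<close>[of s t] local \<open>0 \<le> s\<close> \<open>s \<le> 1\<close> by force
      then show ?case by blast
    qed
    then show ?case by auto
  qed
  then show ?thesis by (simp add: R_def)
qed

text \<open>The value at \<open>p\<close> is the increment along a chosen path from a base point.
  The choice is harmless because increments along loops vanish.\<close>

theorem simply_connected_primitive: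
  assumes S: "simply_connected S"
  shows "\<exists>\<phi>. \<forall>U f. (U, f) \<in> P \<longrightarrow> (\<forall>p\<in>U. \<forall>q\<in>U. \<phi> q - \<phi> p = f q - f p)"
proof (cases "S = {}")
  case True
  then show ?thesis using domain by blast
next
  case False
  then obtain b where b: "b \<in> S" by blast
  have const: "increment (\<lambda>t. p) 0 1 = 0" if p: "p \<in> S" for p
  proof -
    obtain U f where "(U, f) \<in> P" "p \<in> U" using cover p by blast
    then show ?thesis using increment_in_domain[of 0 1 "\<lambda>t. p" U f] by (simp add: image_subset_iff)
  qed
  \<comment> \<open>In the square of a homotopy through loops to a constant, the sides traced by the
    start and the end of the loops coincide and cancel. The constant side contributes 0.\<close>
  have loop: "increment \<gamma> 0 1 = 0" if \<gamma>: "path \<gamma>" "path_image \<gamma> \<subseteq> S" "pathfinish \<gamma> = pathstart \<gamma>" for \<gamma>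
  proof -
    have "homotopic_loops S \<gamma> (\<lambda>t. b)"
      using S[unfolded simply_connected_def, rule_format, of \<gamma> "\<lambda>t. b"] \<gamma> b
      by (simp add: path_def path_image_def pathfinish_def pathstart_def image_subset_iff)
    then obtain h :: "real \<times> real \<Rightarrow> 'a" where h: "continuous_on ({0..1} \<times> {0..1}) h" "h \<in> ({0..1} \<times> {0..1}) \<rightarrow> S"
      "\<forall>t\<in>{0..1}. h (0, t) = \<gamma> t" "\<forall>t\<in>{0..1}. h (1, t) = b" "\<forall>s\<in>{0..1}. h (s, 1) = h (s, 0)"
      unfolding homotopic_loops pathfinish_def pathstart_def o_def by blast
    have im: "h ` ({0..1} \<times> {0..1}) \<subseteq> S" using h(2) by blast
    have "increment (\<lambda>t. h (0, t)) 0 1 = increment \<gamma> 0 1"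
      using \<gamma> h(3) by (intro increment_cong) (auto simp: path_def path_image_def)
    moreover have "increment (\<lambda>t. h (1, t)) 0 1 = 0"
      using increment_cong[of 0 1 "\<lambda>t. b" "\<lambda>t. h (1, t)"] b h(4) const[OF b] by auto
    moreover have "increment (\<lambda>s. h (s, 1)) 0 1 = increment (\<lambda>s. h (s, 0)) 0 1"
      using h(5) im by (intro increment_cong continuous_on_compose2[OF h(1)] continuous_intros) auto
    ultimately show ?thesis
      using increment_rectangle[OF h(1) im] by simp
  qed
  \<comment> \<open>\<open>simply_connected\<close> makes any two loops homotopic, so a homotopy
    between constant loops supplies a connecting path.\<close>
  have "\<exists>\<gamma>. path \<gamma> \<and> path_image \<gamma> \<subseteq> S \<and> pathstart \<gamma> = b \<and> pathfinish \<gamma> = p" if "p \<in> S" for p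
  proof -
    have "homotopic_loops S (\<lambda>t. b) (\<lambda>t. p)"
      using S[unfolded simply_connected_def, rule_format, of "\<lambda>t. b" "\<lambda>t. p"] b that
      by (simp add: path_def path_image_def pathfinish_def pathstart_def image_subset_iff)
    then obtain h :: "real \<times> real \<Rightarrow> 'a" where h: "continuous_on ({0..1} \<times> {0..1}) h"
      "h \<in> ({0..1} \<times> {0..1}) \<rightarrow> S" "\<forall>t\<in>{0..1}. h (0, t) = b" "\<forall>t\<in>{0..1}. h (1, t) = p"
      unfolding homotopic_loops by blast
    have "path (\<lambda>s. h (s, 0))"
      unfolding path_def by (intro continuous_on_compose2[OF h(1)] continuous_intros) auto
    then show ?thesis
      using h(2-4) by (intro exI[of _ "\<lambda>s. h (s, 0)"]) (auto simp: path_image_def pathstart_def pathfinish_def)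
  qed
  then obtain \<gamma> where \<gamma>: "\<And>p. p \<in> S \<Longrightarrow> path (\<gamma> p) \<and> path_image (\<gamma> p) \<subseteq> S \<and> pathstart (\<gamma> p) = b \<and> pathfinish (\<gamma> p) = p"
    by metis
  have "increment (\<gamma> q) 0 1 - increment (\<gamma> p) 0 1 = f q - f p"
    if U: "(U, f) \<in> P" and pq: "p \<in> U" "q \<in> U" for U f p q
  proof -
    have US: "U \<subseteq> S" and "path_connected U" using domain[OF U] by auto
    then obtain \<delta> where \<delta>: "path \<delta>" "path_image \<delta> \<subseteq> U" "pathstart \<delta> = p" "pathfinish \<delta> = q"
      using pq unfolding path_connected_def by blast
    have p: "p \<in> S" and q: "q \<in> S" using pq US by auto
    have "increment \<delta> 0 1 = f q - f p"
      using increment_in_domain[of 0 1 \<delta> U f] \<delta> U by (simp add: path_def path_image_def pathfinish_def pathstart_def)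
    moreover have "increment (\<gamma> p +++ (\<delta> +++ reversepath (\<gamma> q))) 0 1 = 0"
      using \<gamma>[OF p] \<gamma>[OF q] \<delta> US by (intro loop) (auto simp: path_image_join)
    moreover have "increment (\<gamma> p +++ (\<delta> +++ reversepath (\<gamma> q))) 0 1 =
        increment (\<gamma> p) 0 1 + (increment \<delta> 0 1 - increment (\<gamma> q) 0 1)"
      using \<gamma>[OF p] \<gamma>[OF q] \<delta> US
      by (simp add: increment_join increment_reversepath path_image_join subset_trans[OF \<delta>(2)])
    ultimately show ?thesis by simp
  qed
  then show ?thesis by (intro exI[of _ "\<lambda>p. increment (\<gamma> p) 0 1"]) blast
qed

end

subsection \<open>Closed forms on simply connected manifolds\<close>

text \<open>Poincare's lemma, with the primitive given by integrating \<open>w\<close> along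
  segments from \<open>a\<close>. Closedness turns the derivative of the integrand in
  \<open>y\<close> into a total derivative in \<open>t\<close>, whose integral is
  \<open>w y\<close>.\<close>

lemma convex_closed_form_exact:
  fixes w :: "'a::euclidean_space \<Rightarrow> 'a"
  assumes S: "open S" "smooth_on S w" and U: "open U" "convex U" "U \<subseteq> S"
    and closed: "\<And>y u v. y \<in> S \<Longrightarrow> u \<bullet> frechet_derivative w (at y) v = v \<bullet> frechet_derivative w (at y) u"
  shows "\<exists>f. \<forall>y\<in>U. (f has_derivative (\<lambda>h. w y \<bullet> h)) (at y)"
proof (cases "U = {}")
  case False
  then obtain a where a: "a \<in> U" by blast
  define dw where "dw y = frechet_derivative w (at y)" for y
  define c where "c y t = a + t *\<^sub>R (y - a)" for y t
  \<comment> \<open>The \<open>t\<close>-derivative of \<open>t *\<^sub>R w (c y t)\<close>.\<close>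
  define W where "W y t = t *\<^sub>R dw (c y t) (y - a) + w (c y t)" for y t
  have c_in: "c y t \<in> U" if "y \<in> U" "t \<in> cbox 0 1" for y t
  proof -
    have "(1 - t) *\<^sub>R a + t *\<^sub>R y \<in> U"
      using that a U(2) by (intro convexD) auto
    then show ?thesis by (simp add: c_def algebra_simps)
  qed
  have w': "(w has_derivative dw y) (at y)" if "y \<in> U" for y
    unfolding dw_def using that U by (intro smooth_on_has_derivative[OF S]) auto
  have lin: "bounded_linear (dw y)" if "y \<in> U" for y
    using w'[OF that] by (rule has_derivative_bounded_linear)
  have cont_w: "continuous_on U w"
    using smooth_on_continuous_on[OF S] U(3) continuous_on_subset by blast
  have cont_dw: "continuous_on U (\<lambda>y. dw y v)" for v
    unfolding dw_def
    using smooth_on_continuous_on[OF S(1) smooth_on_frechet_derivative[OF S]] U(3) continuous_on_subset by blast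
  have cont_W: "continuous_on (U \<times> cbox 0 1) (\<lambda>(y, t). W y t)"
  proof -
    have cc: "continuous_on (U \<times> cbox 0 1) (\<lambda>z. c (fst z) (snd z))"
      unfolding c_def by (intro continuous_intros)
    have im: "(\<lambda>z. c (fst z) (snd z)) ` (U \<times> cbox 0 1) \<subseteq> U" using c_in by auto
    \<comment> \<open>Continuity of \<open>dw\<close> is known for fixed directions only, while
      \<open>fst z - a\<close> varies; hence the expansion in \<open>Basis\<close>.\<close>
    have "continuous_on (U \<times> cbox 0 1)
      (\<lambda>z. snd z *\<^sub>R (\<Sum>b\<in>Basis. ((fst z - a) \<bullet> b) *\<^sub>R dw (c (fst z) (snd z)) b) + w (c (fst z) (snd z)))"
      by (intro continuous_intros continuous_on_compose2[OF cont_w cc im] continuous_on_compose2[OF cont_dw cc im])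
    moreover have "W (fst z) (snd z) = snd z *\<^sub>R (\<Sum>b\<in>Basis. ((fst z - a) \<bullet> b) *\<^sub>R dw (c (fst z) (snd z)) b) + w (c (fst z) (snd z))"
      if "z \<in> U \<times> cbox 0 1" for z
    proof -
      interpret bounded_linear "dw (c (fst z) (snd z))"
        using that c_in by (intro lin) auto
      have "dw (c (fst z) (snd z)) (fst z - a) =
          dw (c (fst z) (snd z)) (\<Sum>b\<in>Basis. ((fst z - a) \<bullet> b) *\<^sub>R b)"
        by (simp only: euclidean_representation)
      also have "\<dots> = (\<Sum>b\<in>Basis. ((fst z - a) \<bullet> b) *\<^sub>R dw (c (fst z) (snd z)) b)"
        by (simp only: sum scaleR)
      finally show ?thesis unfolding W_def by simp
    qed
    ultimately show ?thesis
      unfolding case_prod_beta by (subst continuous_on_cong[OF refl]) auto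
  qed
  have int_W: "((\<lambda>t. W y t) has_integral w y) (cbox 0 1)" if y: "y \<in> U" for y
  proof -
    have "((\<lambda>t. W y t) has_integral (1 *\<^sub>R w (c y 1) - 0 *\<^sub>R w (c y 0))) {0..1}"
    proof (rule fundamental_theorem_of_calculus)
      fix t :: real assume t: "t \<in> {0..1}"
      have cy: "c y t \<in> U" using c_in[OF y] t by auto
      interpret bounded_linear "dw (c y t)" by (rule lin[OF cy])
      have "((\<lambda>t. w (c y t)) has_derivative (\<lambda>h. dw (c y t) (h *\<^sub>R (y - a)))) (at t within {0..1})"
        using cy by (intro has_derivative_compose[OF _ w', where f = "c y"])
          (auto simp: c_def[abs_def] intro!: derivative_eq_intros)
      then have "((\<lambda>t. w (c y t)) has_vector_derivative dw (c y t) (y - a)) (at t within {0..1})"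
        by (simp add: has_vector_derivative_def scaleR)
      then show "((\<lambda>t. t *\<^sub>R w (c y t)) has_vector_derivative W y t) (at t within {0..1})"
        unfolding W_def
        by (auto intro!: derivative_eq_intros has_vector_derivative_scaleR simp: algebra_simps)
    qed simp
    then show ?thesis by (simp add: c_def)
  qed
  define f where "f y = integral (cbox 0 1) (\<lambda>t. w (c y t) \<bullet> (y - a))" for y
  have "(f has_derivative (\<lambda>h. w y \<bullet> h)) (at y)" if y: "y \<in> U" for y
  proof -
    have "(f has_derivative blinfun_apply (integral (cbox 0 1) (\<lambda>t. blinfun_inner_right (W y t)))) (at y within U)"
      unfolding f_def
    proof (rule leibniz_rule[OF _ _ _ y U(2)])
      fix z t assume z: "z \<in> U" and t: "t \<in> cbox 0 (1::real)"
      note cz = c_in[OF z t]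
      interpret bounded_linear "dw (c z t)" by (rule lin[OF cz])
      have "((\<lambda>y. w (c y t)) has_derivative (\<lambda>h. dw (c z t) (t *\<^sub>R h))) (at z within U)"
        using cz by (intro has_derivative_compose[OF _ w', where f = "\<lambda>y. c y t"])
          (auto simp: c_def intro!: derivative_eq_intros)
      then have "((\<lambda>y. w (c y t) \<bullet> (y - a)) has_derivative
          (\<lambda>h. w (c z t) \<bullet> h + dw (c z t) (t *\<^sub>R h) \<bullet> (z - a))) (at z within U)"
        by (auto intro!: derivative_eq_intros)
      \<comment> \<open>Closedness exchanges \<open>h\<close> with \<open>z - a\<close>, so that the
        derivative of the integrand is the inner product of \<open>W z t\<close> with
        \<open>h\<close>.\<close>
      moreover have "dw (c z t) (t *\<^sub>R h) \<bullet> (z - a) = (t *\<^sub>R dw (c z t) (z - a)) \<bullet> h" for h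
        using closed[of "c z t" "z - a" h] cz U(3)
        by (simp add: dw_def[symmetric] scaleR inner_commute subset_iff)
      ultimately show "((\<lambda>y. w (c y t) \<bullet> (y - a)) has_derivative blinfun_apply (blinfun_inner_right (W z t))) (at z within U)"
        by (elim has_derivative_eq_rhs) (simp add: W_def inner_add_left fun_eq_iff)
    next
      fix z assume z: "z \<in> U"
      show "(\<lambda>t. w (c z t) \<bullet> (z - a)) integrable_on cbox 0 1"
        using c_in[OF z]
        by (intro integrable_continuous continuous_intros continuous_on_compose2[OF cont_w])
          (auto simp: c_def intro!: continuous_intros)
    next
      show "continuous_on (U \<times> cbox 0 1) (\<lambda>(y, t). blinfun_inner_right (W y t))"
        using bounded_linear.continuous_on[OF bounded_linear_blinfun_inner_right cont_W]
        by (simp add: case_prod_beta)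
    qed
    moreover have "integral (cbox 0 1) (\<lambda>t. blinfun_inner_right (W y t)) = blinfun_inner_right (w y)"
      using has_integral_linear[OF int_W[OF y] bounded_linear_blinfun_inner_right]
      by (intro integral_unique) (simp add: o_def)
    ultimately show ?thesis
      using at_within_open[OF y U(1)] by simp
  qed
  then show ?thesis by blast
qed simp

section \<open>Gluing primitives over the atlas, and the converse direction\<close>

context
  fixes A :: "('a::{second_countable_topology,t2_space}, 'n::finite) chart set"
  assumes M: "oriented_manifold A"
begin

lemma open_param_image:
  assumes "x \<in> A" "open B" "B \<subseteq> coord x ` chart_dom x"
  shows "open (param x ` B)"
proof -
  note ch = manifold_chart[OF M assms(1)]
  have "continuous_on (chart_dom x) (coord x)"
    using ch by (simp add: is_chart_def homeomorphism_def)
  then have "open (chart_dom x \<inter> coord x -` B)"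
    by (rule continuous_open_preimage[OF _ open_chart_dom[OF M assms(1)] assms(2)])
  moreover have "param x ` B = chart_dom x \<inter> coord x -` B"
  proof
    show "param x ` B \<subseteq> chart_dom x \<inter> coord x -` B"
      using assms(3) param_in_dom[OF ch] coord_param[OF ch] by auto
    show "chart_dom x \<inter> coord x -` B \<subseteq> param x ` B"
    proof
      fix q assume "q \<in> chart_dom x \<inter> coord x -` B"
      then show "q \<in> param x ` B"
        using param_coord[OF ch, of q] by (intro image_eqI[of _ _ "coord x q"]) auto
    qed
  qed
  ultimately show ?thesis by simp
qed

context
  fixes \<omega> :: "('a, 'n) chart \<Rightarrow> 'a \<Rightarrow> real ^ 'n"
  assumes smooth: "\<And>x. x \<in> A \<Longrightarrow> smooth_in_chart x (\<omega> x)"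
    and closed: "\<And>x p u v. x \<in> A \<Longrightarrow> p \<in> chart_dom x \<Longrightarrow>
      u \<bullet> chart_derivative x (\<omega> x) p v = v \<bullet> chart_derivative x (\<omega> x) p u"
    and change: "\<And>x y p h. x \<in> A \<Longrightarrow> y \<in> A \<Longrightarrow> p \<in> chart_dom x \<Longrightarrow> p \<in> chart_dom y \<Longrightarrow>
      \<omega> x p \<bullet> h = \<omega> y p \<bullet> (transition_jacobian x y p *v h)"
begin

text \<open>Balls are used because convexity gives both Poincare's lemma and path-connected images.
  \<open>f\<close> is a function of the coordinates.\<close>

definition ball_primitive :: "('a, 'n) chart \<Rightarrow> (real ^ 'n) set \<Rightarrow> (real ^ 'n \<Rightarrow> real) \<Rightarrow> bool" where
  "ball_primitive x B f \<longleftrightarrow> x \<in> A \<and> (\<exists>a r. B = ball a r) \<and> B \<subseteq> coord x ` chart_dom x \<and>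
     (\<forall>z\<in>B. (f has_derivative (\<lambda>h. \<omega> x (param x z) \<bullet> h)) (at z))"

lemma ball_primitive_exists:
  assumes x: "x \<in> A" and p: "p \<in> chart_dom x"
  shows "\<exists>B f. ball_primitive x B f \<and> coord x p \<in> B"
proof -
  note ch = manifold_chart[OF M x]
  obtain r where r: "r > 0" "ball (coord x p) r \<subseteq> coord x ` chart_dom x"
    using open_chart_image[OF ch] p openE by blast
  have "\<exists>f. \<forall>z\<in>ball (coord x p) r. (f has_derivative (\<lambda>h. \<omega> x (param x z) \<bullet> h)) (at z)"
  proof (rule convex_closed_form_exact[OF open_chart_image[OF ch] _ open_ball convex_ball r(2)])
    show "smooth_on (coord x ` chart_dom x) (\<lambda>z. \<omega> x (param x z))"
      using smooth[OF x] by (simp add: smooth_in_chart_iff)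
    show "u \<bullet> frechet_derivative (\<lambda>z. \<omega> x (param x z)) (at z) v =
      v \<bullet> frechet_derivative (\<lambda>z. \<omega> x (param x z)) (at z) u" if "z \<in> coord x ` chart_dom x" for z u v
      using closed[OF x param_in_dom[OF ch that], of u v]
      by (simp add: chart_derivative_def coord_param[OF ch that])
  qed
  then show ?thesis
    unfolding ball_primitive_def using x r by (metis centre_in_ball)
qed

text \<open>Allows primitives from two charts to be compared in the coordinates of one: the Jacobian
  from the chain rule is absorbed by the transformation law of \<open>\<omega>\<close>.\<close>

lemma ball_primitive_has_derivative:
  assumes y: "ball_primitive y B f" and x: "x \<in> A" and q: "q \<in> chart_dom x" "q \<in> param y ` B"
  shows "((\<lambda>z. f (coord y (param x z))) has_derivative (\<lambda>h. \<omega> x q \<bullet> h)) (at (coord x q))"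
proof -
  have yA: "y \<in> A" and B: "open B" "B \<subseteq> coord y ` chart_dom y"
    using y unfolding ball_primitive_def by auto
  note ch = manifold_chart[OF M yA]
  obtain z where z: "z \<in> B" "q = param y z" using q by blast
  have zq: "coord y q = z" using z B coord_param[OF ch] by blast
  have qy: "q \<in> chart_dom y" using z B param_in_dom[OF ch] by blast
  have "(f has_derivative (\<lambda>h. \<omega> y q \<bullet> h)) (at (coord y q))"
    using y z zq unfolding ball_primitive_def by auto
  then have "((\<lambda>z. f (coord y (param y z))) has_derivative (\<lambda>h. \<omega> y q \<bullet> h)) (at (coord y q))"
    by (rule has_derivative_transform_within_open[OF _ B(1)])
      (use zq z B coord_param[OF ch] in auto)
  from has_derivative_change_chart[OF M x yA q(1) qy this]
  show ?thesis
    by (simp add: change[OF x yA q(1) qy])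
qed

text \<open>On a small coordinate ball the difference of two primitives has derivative zero, hence
  is constant. The intersection of two domains may be disconnected, so agreement is only claimed
  near each point.\<close>

lemma ball_primitives:
  "local_primitives (points A) {(param x ` B, \<lambda>q. f (coord x q)) | x B f. ball_primitive x B f}"
proof
  fix p assume "p \<in> points A"
  then obtain x where x: "x \<in> A" "p \<in> chart_dom x" by (auto simp: points_def)
  obtain B f where B: "ball_primitive x B f" "coord x p \<in> B"
    using ball_primitive_exists[OF x] by blast
  then have "p \<in> param x ` B"
    using param_coord[OF manifold_chart[OF M x(1)] x(2)] by (metis imageI)
  then show "\<exists>U f. (U, f) \<in> {(param x ` B, \<lambda>q. f (coord x q)) | x B f. ball_primitive x B f} \<and> p \<in> U"
    using B(1) by blast
next
  fix U and F :: "'a \<Rightarrow> real"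
  assume "(U, F) \<in> {(param x ` B, \<lambda>q. f (coord x q)) | x B f. ball_primitive x B f}"
  then obtain x B f where U: "U = param x ` B" and B: "ball_primitive x B f" by blast
  then have x: "x \<in> A" and Bd: "open B" "convex B" "B \<subseteq> coord x ` chart_dom x"
    unfolding ball_primitive_def by auto
  note ch = manifold_chart[OF M x]
  have "continuous_on B (param x)"
    using ch Bd(3) unfolding is_chart_def homeomorphism_def by (meson continuous_on_subset)
  then have "path_connected U"
    unfolding U by (intro path_connected_continuous_image convex_imp_path_connected Bd)
  moreover have "U \<subseteq> points A"
    unfolding U points_def using x Bd(3) param_in_dom[OF ch] by blast
  ultimately show "open U \<and> path_connected U \<and> U \<subseteq> points A"
    unfolding U using open_param_image[OF x Bd(1,3)] by blast
next
  fix U V p and F G :: "'a \<Rightarrow> real"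
  let ?P = "{(param x ` B, \<lambda>q. f (coord x q)) | x B f. ball_primitive x B f}"
  assume U: "(U, F) \<in> ?P" "p \<in> U" and V: "(V, G) \<in> ?P" "p \<in> V"
  obtain x B f where Ux: "U = param x ` B" "F = (\<lambda>q. f (coord x q))" and B: "ball_primitive x B f"
    using U by blast
  obtain y C f' where Vy: "V = param y ` C" "G = (\<lambda>q. f' (coord y q))" and C: "ball_primitive y C f'"
    using V by blast
  have x: "x \<in> A" and Bd: "open B" "B \<subseteq> coord x ` chart_dom x"
    using B unfolding ball_primitive_def by auto
  have y: "y \<in> A" and Cd: "open C" "C \<subseteq> coord y ` chart_dom y"
    using C unfolding ball_primitive_def by auto
  note ch = manifold_chart[OF M x]
  have "open (U \<inter> V)"
    unfolding Ux Vy by (intro open_Int open_param_image x y Bd Cd)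
  then have "open (coord x ` (chart_dom x \<inter> (U \<inter> V)))"
    by (rule open_overlap_image[OF M x])
  moreover have px: "p \<in> chart_dom x"
    using U(2) Ux Bd param_in_dom[OF ch] by blast
  ultimately obtain e where e: "e > 0" "ball (coord x p) e \<subseteq> coord x ` (chart_dom x \<inter> (U \<inter> V))"
    using U(2) V(2) by (meson IntI imageI openE)
  let ?E = "ball (coord x p) e"
  have "((\<lambda>z. F (param x z) - G (param x z)) has_derivative (\<lambda>h. 0)) (at z within ?E)" if z: "z \<in> ?E" for z
  proof -
    obtain q where q: "q \<in> chart_dom x" "q \<in> U" "q \<in> V" "z = coord x q"
      using e z by blast
    have "((\<lambda>z. F (param x z) - G (param x z)) has_derivative (\<lambda>h. \<omega> x q \<bullet> h - \<omega> x q \<bullet> h)) (at z)"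
      unfolding Ux Vy q(4)
      by (intro has_derivative_diff ball_primitive_has_derivative[OF B x] ball_primitive_has_derivative[OF C x])
        (use q Ux Vy in auto)
    then show ?thesis by (simp add: has_derivative_at_withinI)
  qed
  then have "\<exists>k. \<forall>z\<in>?E. F (param x z) - G (param x z) = k"
    by (rule has_derivative_zero_constant[OF convex_ball])
  then obtain k where k: "\<And>z. z \<in> ?E \<Longrightarrow> F (param x z) - G (param x z) = k"
    by blast
  have "F q - F p = G q - G p" if q: "q \<in> param x ` ?E" for q
  proof -
    obtain z where "z \<in> ?E" "q = param x z" using q by blast
    then show ?thesis
      using k[of z] k[of "coord x p"] e(1) param_coord[OF ch px] by simp
  qed
  moreover have "p \<in> param x ` ?E"
    using e(1) param_coord[OF ch px] by (metis centre_in_ball imageI)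
  moreover have "open (param x ` ?E)"
    using e(2) by (intro open_param_image[OF x]) auto
  ultimately show "\<exists>W. open W \<and> p \<in> W \<and> (\<forall>q\<in>W. F q - F p = G q - G p)"
    by blast
qed

lemma closed_form_primitive:
  assumes "simply_connected (points A)"
  obtains \<phi> where "\<And>x p. x \<in> A \<Longrightarrow> p \<in> chart_dom x \<Longrightarrow>
    ((\<lambda>z. \<phi> (param x z)) has_derivative (\<lambda>h. \<omega> x p \<bullet> h)) (at (coord x p))"
proof -
  interpret local_primitives "points A" "{(param x ` B, \<lambda>q. f (coord x q)) | x B f. ball_primitive x B f}"
    by (rule ball_primitives)
  obtain \<phi> where \<phi>0: "\<forall>U f. (U, f) \<in> {(param x ` B, \<lambda>q. f (coord x q)) | x B f. ball_primitive x B f} \<longrightarrow>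
      (\<forall>p\<in>U. \<forall>q\<in>U. \<phi> q - \<phi> p = f q - f p)"
    using simply_connected_primitive[OF assms] ..
  have \<phi>: "\<phi> q - \<phi> p = f (coord x q) - f (coord x p)"
    if "ball_primitive x B f" "p \<in> param x ` B" "q \<in> param x ` B" for x B f p q
    using \<phi>0[rule_format, of "param x ` B" "\<lambda>q. f (coord x q)" p q] that by blast
  show thesis
  proof (rule that)
    fix x p assume x: "x \<in> A" and p: "p \<in> chart_dom x"
    note ch = manifold_chart[OF M x]
    obtain B f where B: "ball_primitive x B f" "coord x p \<in> B"
      using ball_primitive_exists[OF x p] by blast
    have Bd: "open B" "B \<subseteq> coord x ` chart_dom x"
      using B unfolding ball_primitive_def by auto
    have "(f has_derivative (\<lambda>h. \<omega> x p \<bullet> h)) (at (coord x p))"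
      using B param_coord[OF ch p] unfolding ball_primitive_def by force
    \<comment> \<open>On \<open>B\<close> the global function differs from \<open>f\<close> by a
      constant, read off at \<open>p\<close>.\<close>
    then have "((\<lambda>z. f z + (\<phi> p - f (coord x p))) has_derivative (\<lambda>h. \<omega> x p \<bullet> h)) (at (coord x p))"
      by (auto intro!: derivative_eq_intros)
    then show "((\<lambda>z. \<phi> (param x z)) has_derivative (\<lambda>h. \<omega> x p \<bullet> h)) (at (coord x p))"
    proof (rule has_derivative_transform_within_open[OF _ Bd(1) B(2)])
      fix z assume z: "z \<in> B"
      have "p \<in> param x ` B" using B(2) param_coord[OF ch p] by (metis imageI)
      then have "\<phi> (param x z) - \<phi> p = f (coord x (param x z)) - f (coord x p)"
        using z by (intro \<phi>[OF B(1)]) auto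
      moreover have "coord x (param x z) = z" using z Bd by (intro coord_param[OF ch]) auto
      ultimately show "f z + (\<phi> p - f (coord x p)) = \<phi> (param x z)" by simp
    qed
  qed
qed

end

lemma parallel_imp_limiting_carleman_weight:
  assumes g: "riemannian_metric A g" and S: "simply_connected (points A)"
    and parallel: "parallel_field A g X" and unit: "unit_field A g X"
  shows "\<exists>\<phi>. limiting_carleman_weight A g \<phi>"
proof -
  define \<omega> where "\<omega> x p = g x p *v X x p" for x p
  have vf: "vector_field A X" using parallel by (simp add: parallel_field_def)
  have smX: "smooth_in_chart x (X x)" if "x \<in> A" for x
    using vf that by (simp add: vector_field_def)
  have cov: "riemannian_chart.covariant_form x g (X x) p v w = 0" if "x \<in> A" "p \<in> chart_dom x" for x p v w
    using parallel that
      riemannian_chart.covariant_derivative_zero_iff[OF riemannian_metric_chart[OF M g that(1)], where X = X, OF smX[OF that(1)] that(2)]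
    by (simp add: parallel_field_def)
  have sm: "smooth_in_chart x (\<omega> x)" if "x \<in> A" for x
    unfolding \<omega>_def by (intro riemannian_chart.smooth_lower[OF riemannian_metric_chart[OF M g that]] smX that)
  \<comment> \<open>Subtracting the instances \<open>(u, v)\<close> and \<open>(v, u)\<close> of
    \<open>DX = 0\<close> cancels the derivative of the metric along \<open>X\<close> and leaves the
    antisymmetric part of the derivative of \<open>\<omega>\<close>.\<close>
  have closed: "u \<bullet> chart_derivative x (\<omega> x) p v = v \<bullet> chart_derivative x (\<omega> x) p u"
    if x: "x \<in> A" "p \<in> chart_dom x" for x p u v
  proof -
    interpret X: riemannian_chart x g by (rule riemannian_metric_chart[OF M g x(1)])
    have "chart_derivative x (\<omega> x) p h = g x p *v chart_derivative x (X x) p h + chart_derivative x (g x) p h *v X x p" for h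
      by (subst chart_derivativeI[OF X.has_derivative_lower[OF smX[OF x(1)] x(2), folded \<omega>_def]]) simp
    then show ?thesis
      using cov[OF x, of u v] cov[OF x, of v u] X.metric_derivative_commute[OF x(2), of u "X x p" v]
      by (simp add: X.covariant_form_def inner_add_right) argo
  qed
  have change: "\<omega> x p \<bullet> h = \<omega> y p \<bullet> (transition_jacobian x y p *v h)"
    if "x \<in> A" "y \<in> A" "p \<in> chart_dom x" "p \<in> chart_dom y" for x y p h
  proof -
    define J where "J = transition_jacobian x y p"
    have "g x p = transpose J ** g y p ** J" "X y p = J *v X x p"
      using g vf that unfolding riemannian_metric_def vector_field_def J_def by blast+
    then have "\<omega> x p = transpose J *v \<omega> y p"
      by (simp add: \<omega>_def matrix_vector_mul_assoc matrix_mul_assoc del: transpose_matrix_vector)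
    then show ?thesis
      by (simp add: J_def dot_lmul_matrix)
  qed
  obtain \<phi> where \<phi>: "\<And>x p. x \<in> A \<Longrightarrow> p \<in> chart_dom x \<Longrightarrow>
    ((\<lambda>z. \<phi> (param x z)) has_derivative (\<lambda>h. \<omega> x p \<bullet> h)) (at (coord x p))"
    using closed_form_primitive[OF sm closed change S] by blast
  have sm\<phi>: "smooth_in_chart x \<phi>" if x: "x \<in> A" for x
    unfolding smooth_in_chart_iff
  proof (rule smooth_onI[OF open_chart_image[OF manifold_chart[OF M x]]])
    fix z assume z: "z \<in> coord x ` chart_dom x"
    show "((\<lambda>z. \<phi> (param x z)) has_derivative (\<lambda>h. \<omega> x (param x z) \<bullet> h)) (at z)"
      using \<phi>[OF x param_in_dom[OF manifold_chart[OF M x] z]]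
      by (simp add: coord_param[OF manifold_chart[OF M x] z])
  next
    show "smooth_on (coord x ` chart_dom x) (\<lambda>z. \<omega> x (param x z) \<bullet> v)" for v
      by (rule smooth_on_bounded_linear[OF open_chart_image[OF manifold_chart[OF M x]]
            bounded_linear_inner_left sm[OF x, unfolded smooth_in_chart_iff]])
  qed
  have d\<phi>: "differential \<phi> x p = \<omega> x p" if x: "x \<in> A" "p \<in> chart_dom x" for x p
  proof -
    have "differential \<phi> x p \<bullet> v = \<omega> x p \<bullet> v" for v
      using differential_eq_chart_derivative[OF manifold_chart[OF M x(1)] sm\<phi>[OF x(1)] x(2)]
      by (simp add: chart_derivativeI[OF \<phi>[OF x]])
    then show ?thesis using vector_eq_rdot by blast
  qed
  have "differential \<phi> x p \<noteq> 0" if x: "x \<in> A" "p \<in> chart_dom x" for x p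
    using unit x by (force simp: d\<phi>[OF x] \<omega>_def unit_field_def)
  moreover have "riemannian_chart.carleman_condition x g \<phi> p" if x: "x \<in> A" "p \<in> chart_dom x" for x p
  proof -
    interpret X: riemannian_chart x g by (rule riemannian_metric_chart[OF M g x(1)])
    have grad: "X.gradient \<phi> q = X x q" if "q \<in> chart_dom x" for q
      using that d\<phi>[OF x(1) that] by (simp add: X.gradient_def \<omega>_def X.metric_inv)
    \<comment> \<open>The form contains a derivative of the field, so the fields must agree on the
      whole chart domain and not just at \<open>p\<close>.\<close>
    have "X.covariant_form (X.gradient \<phi>) p v v = X.covariant_form (X x) p v v" for v
      unfolding X.covariant_form_def
      by (simp add: grad[OF x(2)] chart_derivative_cong[OF X.chart x(2) grad])
    then show ?thesis
      unfolding X.carleman_condition_def X.hessian_form_eq_covariant_form[OF sm\<phi>[OF x(1)] x(2)]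
      using cov[OF x] by simp
  qed
  ultimately show ?thesis
    unfolding limiting_carleman_weight_iff[OF M g] smooth_function_def
    using sm\<phi> by (intro exI[of _ \<phi>] conjI ballI)
qed

end

theorem theorem1:
  fixes A :: "('a::{second_countable_topology,t2_space}, 'n::finite) chart set"
    and g :: "('a, 'n) metric_components"
  assumes "open_manifold A"
    and "riemannian_metric A g"
  shows "((\<exists>\<phi>. limiting_carleman_weight A g \<phi>) \<longrightarrow>
            (\<exists>c. smooth_function A c \<and> (\<forall>p\<in>points A. 0 < c p) \<and>
              (\<exists>X. parallel_field A (conformal_metric c g) X \<and>
                   unit_field A (conformal_metric c g) X))) \<and>
         (simply_connected (points A) \<longrightarrow>
            (\<exists>c. smooth_function A c \<and> (\<forall>p\<in>points A. 0 < c p) \<and>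
              (\<exists>X. parallel_field A (conformal_metric c g) X \<and>
                   unit_field A (conformal_metric c g) X)) \<longrightarrow>
            (\<exists>\<phi>. limiting_carleman_weight A g \<phi>))"
proof -
  have M: "oriented_manifold A" using assms(1) by (simp add: open_manifold_def)
  show ?thesis
  proof (intro conjI impI)
    assume "\<exists>\<phi>. limiting_carleman_weight A g \<phi>"
    then show "\<exists>c. smooth_function A c \<and> (\<forall>p\<in>points A. 0 < c p) \<and>
        (\<exists>X. parallel_field A (conformal_metric c g) X \<and> unit_field A (conformal_metric c g) X)"
      using limiting_carleman_weight_imp_parallel[OF M assms(2)] by blast
  next
    assume S: "simply_connected (points A)" and "\<exists>c. smooth_function A c \<and> (\<forall>p\<in>points A. 0 < c p) \<and>
        (\<exists>X. parallel_field A (conformal_metric c g) X \<and> unit_field A (conformal_metric c g) X)"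
    then obtain c X where c: "smooth_function A c" "\<forall>p\<in>points A. 0 < c p"
      and X: "parallel_field A (conformal_metric c g) X" "unit_field A (conformal_metric c g) X"
      by blast
    \<comment> \<open>The weight is obtained for \<open>c g\<close> and is then one for
      \<open>g\<close> by conformal invariance.\<close>
    show "\<exists>\<phi>. limiting_carleman_weight A g \<phi>"
      using parallel_imp_limiting_carleman_weight[OF M riemannian_metric_conformal[OF M assms(2) c] S X]
        limiting_carleman_weight_conformal[OF M assms(2) c] by blast
  qed
qed

end
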